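(* Let $A\in\mathcal L(\mathcal H_2,\mathcal X)$, $\mathbf x\in\mathcal X$ and let $T_2\in\mathcal L(\widetilde{\mathcal H}_2,\mathcal H_2)$ be a contraction. Let $F_A=(I-T_2T_2^* )A^*$, regarded as an operator in $\mathcal L(\mathcal X,\mathcal H(T_2))$, and assume that $F_A^{[*]}F_A\succeq\mathbf x\mathbf x^*$. Let $\widetilde{\mathbf x}\in(\operatorname{Ker}F_A)^\perp$ and $\widetilde F_A\in\mathcal L((\operatorname{Ker}F_A)^\perp,\mathcal H(T_2))$ be the unique vector and operator (the latter being an isometry) such that $$\mathbf x=(F_A^{[*]}F_A)^{1/2}\widetilde{\mathbf x},\qquad F_A=\widetilde F_A(F_A^{[*]}F_A)^{1/2},$$ and let $\mathcal N=\overline{\operatorname{Ran}}\big(I_{\mathcal H(T_2)}-\widetilde F_A\widetilde F_A^{[*]}\big)^{1/2}\subset\mathcal H(T_2)$. Then all solutions $g$ to the problem $$g\in\mathcal H(T_2),\qquad Ag=\mathbf x,\qquad\|g\|_{\mathcal H(T_2)}\le1$$ are given by the formula $$g=\widetilde F_A\widetilde{\mathbf x}+h,$$ where $h$ is a free parameter from the subspace $\mathcal N\subset\mathcal H(T_2)$ subject to $\|h\|_{\mathcal H(T_2)}\le\sqrt{1-\|\widetilde{\mathbf x}\|^2_{\mathcal X}}$. Furthermore, the problem has a unique solution if and only if $\|\widetilde{\mathbf x}\|=1$ or $\widetilde F_A\widetilde F_A^{[*]}=I_{\mathcal H(T_2)}$. Furthermore, $$\|g\|^2_{\mathcal H(T_2)}=\|\widetilde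 F_A\widetilde{\mathbf x}\|^2_{\mathcal H(T_2)}+\|h\|^2_{\mathcal H(T_2)}=\|\widetilde{\mathbf x}\|^2_{\mathcal X}+\|h\|^2_{\mathcal H(T_2)}.$$
   Context: $\mathcal X,\mathcal H_2,\widetilde{\mathcal H}_2$ are separable complex Hilbert spaces. For a contraction $T\in\mathcal L(\widetilde{\mathcal H},\mathcal H)$, the generalized de Branges–Rovnyak space is $\mathcal H(T)=\operatorname{Ran}(I-TT^* )^{1/2}\subset\mathcal H$ with the Hilbert-space norm $\|(I-TT^* )^{1/2}y\|_{\mathcal H(T)}=\|(I-\pi)y\|_{\mathcal H}$, $\pi$ the orthogonal projection onto $\operatorname{Ker}(I-TT^* )^{1/2}$. The superscript $[*]$ denotes the adjoint of an operator into $\mathcal H(T_2)$ with respect to the inner product of $\mathcal H(T_2)$. The vector $\mathbf x$ is identified with the operator $\mathbb C\to\mathcal X$, $c\mapsto c\mathbf x$, so $\mathbf x\mathbf x^*\in\mathcal L(\mathcal X)$. The existence and uniqueness of $\widetilde{\mathbf x}$ and $\widetilde F_A$ follow from Douglas' lemma. *)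

theory Defs
  imports "HOL-Analysis.Analysis"
begin

text \<open>
  A complex inner product space is a real one (whose inner product is the real part of the complex
  one) with a compatible multiplication by complex scalars. Inner products are linear in the first
  argument and conjugate-linear in the second.
\<close>

class complex_inner = real_inner +
  fixes scaleC :: "complex \<Rightarrow> 'a \<Rightarrow> 'a"  (infixr "*\<^sub>C" 75)
    and cinner :: "'a \<Rightarrow> 'a \<Rightarrow> complex"
  assumes scaleC_add_right: "c *\<^sub>C (x + y) = c *\<^sub>C x + c *\<^sub>C y"
    and scaleC_add_left: "(c + d) *\<^sub>C x = c *\<^sub>C x + d *\<^sub>C x"
    and scaleC_scaleC: "c *\<^sub>C d *\<^sub>C x = (c * d) *\<^sub>C x"
    and scaleR_scaleC: "r *\<^sub>R x = complex_of_real r *\<^sub>C x"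
    and cinner_commute: "cinner x y = cnj (cinner y x)"
    and cinner_add_left: "cinner (x + y) z = cinner x z + cinner y z"
    and cinner_scaleC_left: "cinner (c *\<^sub>C x) y = c * cinner x y"
    and inner_eq_Re_cinner: "inner x y = Re (cinner x y)"

class chilbert_space = complex_inner + complete_space

instantiation complex :: chilbert_space
begin
definition scaleC_complex :: "complex \<Rightarrow> complex \<Rightarrow> complex"
  where "scaleC_complex c x = c * x"
definition cinner_complex :: "complex \<Rightarrow> complex \<Rightarrow> complex"
  where "cinner_complex x y = x * cnj y"
instance
  by standard
    (auto simp: scaleC_complex_def cinner_complex_def inner_complex_def algebra_simps scaleR_conv_of_real)
end

definition separable :: "'a::topological_space set \<Rightarrow> bool"
  where "separable S \<longleftrightarrow> (\<exists>D. countable D \<and> D \<subseteq> S \<and> S \<subseteq> closure D)"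

text \<open>
  Spaces such as \<open>\<H>(T)\<close> are linear subspaces of an ambient Hilbert space with an inner product of
  their own. A Hilbert space is therefore given by a carrier together with an inner product; the
  vector space operations are those of the ambient type.
\<close>

record 'a ipspace =
  carr :: "'a set"
  ip :: "'a \<Rightarrow> 'a \<Rightarrow> complex"

definition sub_space :: "'a::complex_inner set \<Rightarrow> 'a ipspace"
  where "sub_space S = \<lparr>carr = S, ip = cinner\<rparr>"

definition whole :: "'a::complex_inner ipspace"
  where "whole = sub_space UNIV"

definition hnorm :: "'a ipspace \<Rightarrow> 'a \<Rightarrow> real"
  where "hnorm H x = sqrt (Re (ip H x x))"

lemma hnorm_whole: "hnorm whole x = norm x"
  by (simp add: hnorm_def whole_def sub_space_def norm_eq_sqrt_inner inner_eq_Re_cinner)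

text \<open>
  Bounded operators are extensional (\<open>undefined\<close> off the carrier), so that equality of operators is
  equality of functions and the descriptions below have a unique solution.
\<close>

definition bops :: "'a::complex_inner ipspace \<Rightarrow> 'b::complex_inner ipspace \<Rightarrow> ('a \<Rightarrow> 'b) set"
  where "bops H K = {F \<in> carr H \<rightarrow>\<^sub>E carr K.
     (\<forall>x\<in>carr H. \<forall>y\<in>carr H. F (x + y) = F x + F y) \<and>
     (\<forall>c. \<forall>x\<in>carr H. F (c *\<^sub>C x) = c *\<^sub>C F x) \<and>
     (\<exists>B. \<forall>x\<in>carr H. hnorm K (F x) \<le> B * hnorm H x)}"

definition contraction ::
  "'a::complex_inner ipspace \<Rightarrow> 'b::complex_inner ipspace \<Rightarrow> ('a \<Rightarrow> 'b) \<Rightarrow> bool"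
  where "contraction H K F \<longleftrightarrow> F \<in> bops H K \<and> (\<forall>x\<in>carr H. hnorm K (F x) \<le> hnorm H x)"

definition isometry ::
  "'a::complex_inner ipspace \<Rightarrow> 'b::complex_inner ipspace \<Rightarrow> ('a \<Rightarrow> 'b) \<Rightarrow> bool"
  where "isometry H K F \<longleftrightarrow> F \<in> bops H K \<and> (\<forall>x\<in>carr H. hnorm K (F x) = hnorm H x)"

definition adj :: "'a ipspace \<Rightarrow> 'b ipspace \<Rightarrow> ('a \<Rightarrow> 'b) \<Rightarrow> 'b \<Rightarrow> 'a"
  where "adj H K F = (\<lambda>y\<in>carr K. THE z. z \<in> carr H \<and> (\<forall>x\<in>carr H. ip K (F x) y = ip H x z))"

text \<open>On a complex space a positive semidefinite operator is automatically self-adjoint.\<close>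

definition psd :: "'a::complex_inner ipspace \<Rightarrow> ('a \<Rightarrow> 'a) \<Rightarrow> bool"
  where "psd H P \<longleftrightarrow> P \<in> bops H H \<and> (\<forall>x\<in>carr H. ip H (P x) x \<in> \<real> \<and> 0 \<le> Re (ip H (P x) x))"

definition loewner_ge :: "'a::complex_inner ipspace \<Rightarrow> ('a \<Rightarrow> 'a) \<Rightarrow> ('a \<Rightarrow> 'a) \<Rightarrow> bool"
  where "loewner_ge H P Q \<longleftrightarrow> psd H (\<lambda>x\<in>carr H. P x - Q x)"

definition op_sqrt :: "'a::complex_inner ipspace \<Rightarrow> ('a \<Rightarrow> 'a) \<Rightarrow> 'a \<Rightarrow> 'a"
  where "op_sqrt H P = (THE R. psd H R \<and> (\<forall>x\<in>carr H. R (R x) = P x))"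

definition hker :: "('a \<Rightarrow> 'b::zero) \<Rightarrow> 'a set"
  where "hker F = {x. F x = 0}"

definition orth_compl :: "'a::complex_inner set \<Rightarrow> 'a set"
  where "orth_compl S = {x. \<forall>y\<in>S. cinner x y = 0}"

definition orth_proj :: "'a::complex_inner set \<Rightarrow> 'a \<Rightarrow> 'a"
  where "orth_proj M x = (THE p. p \<in> M \<and> x - p \<in> orth_compl M)"

definition hclosure :: "'a::complex_inner ipspace \<Rightarrow> 'a set \<Rightarrow> 'a set"
  where "hclosure H S = {x \<in> carr H. \<forall>e>0. \<exists>s\<in>S. hnorm H (x - s) < e}"

definition defect_sqrt :: "('a::complex_inner \<Rightarrow> 'b::complex_inner) \<Rightarrow> 'b \<Rightarrow> 'b"
  where "defect_sqrt T = op_sqrt whole (\<lambda>y. y - T (adj whole whole T y))"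

text \<open>
  The de Branges--Rovnyak space \<open>\<H>(T)\<close>. With \<open>Q = (I - T T\<^sup>*)\<^sup>1\<^sup>/\<^sup>2\<close> and \<open>\<pi>\<close> the orthogonal projection
  onto \<open>Ker Q\<close>, the inner product of \<open>Q y\<close> and \<open>Q z\<close> is that of \<open>(I - \<pi>) y\<close> and \<open>(I - \<pi>) z\<close>. This
  depends only on \<open>Q y\<close> and \<open>Q z\<close>, and it is the inner product whose norm is
  \<open>\<parallel>Q y\<parallel> = \<parallel>(I - \<pi>) y\<parallel>\<close>.
\<close>

definition dBR :: "('a::complex_inner \<Rightarrow> 'b::complex_inner) \<Rightarrow> 'b ipspace"
  where "dBR T = (let Q = defect_sqrt T; \<pi> = orth_proj (hker Q) in
     \<lparr>carr = range Q,
      ip = (\<lambda>u v. THE c. \<exists>y z. u = Q y \<and> v = Q z \<and> c = cinner (y - \<pi> y) (z - \<pi> z))\<rparr>)"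

definition vec_op :: "'a::complex_inner \<Rightarrow> complex \<Rightarrow> 'a"
  where "vec_op x = (\<lambda>c. c *\<^sub>C x)"

end

theory Submission
  imports Defs
begin

text \<open>
  Write \<open>Q = (I - T\<^sub>2 T\<^sub>2\<^sup>*)\<^sup>1\<^sup>/\<^sup>2\<close>. The space \<open>\<H>(T\<^sub>2)\<close> is the range of \<open>Q\<close> with exactly the inner product that
  makes \<open>Q\<close> a unitary operator from \<open>L = (Ker Q)\<^sup>\<bottom>\<close> onto it; let \<open>lift\<close> be its inverse. Everything is
  carried back to \<open>L\<close>, where the inner product is that of the ambient space.

  Put \<open>W = Q A\<^sup>*\<close>. Then \<open>F\<^sub>A = Q W\<close>, the adjoint of \<open>F\<^sub>A\<close> is the restriction of \<open>A\<close> to \<open>\<H>(T\<^sub>2)\<close>, and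
  \<open>F\<^sub>A\<^sup>[\<^sup>*\<^sup>] F\<^sub>A = W\<^sup>* W\<close>. With \<open>S = (W\<^sup>* W)\<^sup>1\<^sup>/\<^sup>2\<close> the polar decomposition \<open>W = V S\<close> gives a partial isometry
  \<open>V\<close> with initial space \<open>(Ker S)\<^sup>\<bottom> = (Ker F\<^sub>A)\<^sup>\<bottom>\<close> and range in \<open>L\<close>, so the isometry \<open>Ft\<close> is \<open>Q V\<close>
  restricted to \<open>(Ker S)\<^sup>\<bottom>\<close>, and its adjoint is \<open>V\<^sup>* lift\<close>. For \<open>g \<in> \<H>(T\<^sub>2)\<close> one has
  \<open>A g = W\<^sup>* lift g = S V\<^sup>* lift g\<close>. As \<open>S\<close> is injective on \<open>(Ker S)\<^sup>\<bottom>\<close>, the equation \<open>A g = x\<close> says that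
  \<open>V\<^sup>* lift g\<close> is the vector \<open>xt\<close> with \<open>S xt = x\<close>. The solutions are therefore the sums of
  \<open>Q V xt\<close>, a vector of norm \<open>\<parallel>xt\<parallel>\<close>, and a vector of the kernel of the adjoint; the two are
  orthogonal, and this kernel is the range of the projection \<open>I - Ft Ft\<^sup>[\<^sup>*\<^sup>]\<close>, which is its own
  square root. The Pythagorean theorem turns \<open>\<parallel>g\<parallel> \<le> 1\<close> into the bound on \<open>\<parallel>h\<parallel>\<close>, and the ball of that
  radius in the kernel is a single point exactly if the radius or the kernel is zero.

  Two analytic facts carry the argument. The lemma \<open>riesz_range\<close> represents a functional that is
  bounded by a multiple of \<open>\<parallel>T x\<parallel>\<close> by a vector in the closed range of \<open>T\<close>; adjoints, orthogonal projections onto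
  kernels, the existence of \<open>xt\<close> with \<open>\<parallel>xt\<parallel> \<le> 1\<close> and the factor \<open>V\<close> are all instances of it. The lemma
  \<open>psd_sqrt_exists\<close> constructs the square root of a positive operator by an iteration and shows that
  it commutes with everything that commutes with the operator, which gives uniqueness.
\<close>

section \<open>Complex inner products and bounded operators\<close>

lemma cinner_add_right: "cinner x (y + z) = cinner x y + cinner x z"
  by (metis cinner_add_left cinner_commute complex_cnj_add)

lemma cinner_scaleC_right: "cinner x (c *\<^sub>C y) = cnj c * cinner x y"
  by (metis cinner_commute cinner_scaleC_left complex_cnj_mult)

lemma scaleC_minus_one: "- x = (- 1) *\<^sub>C (x::'a::complex_inner)"
  using scaleR_scaleC[of "- 1" x] by simp

lemma scaleC_one: "1 *\<^sub>C x = (x::'a::complex_inner)"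
  using scaleR_scaleC[of 1 x] by simp

lemma scaleC_diff_right: "c *\<^sub>C (x - y) = c *\<^sub>C x - c *\<^sub>C (y::'a::complex_inner)"
  by (metis scaleC_add_right add_diff_cancel_right' diff_add_cancel)

lemma scaleC_scaleR: "c *\<^sub>C (r *\<^sub>R x) = r *\<^sub>R (c *\<^sub>C (x::'a::complex_inner))"
  by (simp add: scaleR_scaleC scaleC_scaleC mult.commute)

lemma cinner_zero [simp]: "cinner 0 x = 0" "cinner x 0 = 0"
  by (metis add_cancel_right_right cinner_add_left, metis add_cancel_right_right cinner_add_right)

lemma cinner_minus: "cinner (- x) y = - cinner x y" "cinner x (- y) = - cinner x y"
  by (simp_all only: scaleC_minus_one[of x] scaleC_minus_one[of y] cinner_scaleC_left cinner_scaleC_right) simp_all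

lemma cinner_diff_left: "cinner (x - y) z = cinner x z - cinner y z"
  using cinner_add_left[of x "- y" z] by (simp add: cinner_minus)

lemma cinner_diff_right: "cinner x (y - z) = cinner x y - cinner x z"
  using cinner_add_right[of x y "- z"] by (simp add: cinner_minus)

lemma cinner_scaleR: "cinner (r *\<^sub>R x) y = r * cinner x y" "cinner x (r *\<^sub>R y) = r * cinner x y"
  by (simp_all add: scaleR_scaleC cinner_scaleC_left cinner_scaleC_right)

lemma cinner_self: "cinner x x = complex_of_real ((norm x)\<^sup>2)"
proof (rule complex_eqI)
  show "Re (cinner x x) = Re (complex_of_real ((norm x)\<^sup>2))"
    by (simp add: power2_norm_eq_inner inner_eq_Re_cinner)
  show "Im (cinner x x) = Im (complex_of_real ((norm x)\<^sup>2))"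
    by (metis Reals_cnj_iff Im_complex_of_real cinner_commute complex_is_Real_iff)
qed

lemma norm_scaleC: "norm (c *\<^sub>C x) = cmod c * norm (x::'a::complex_inner)"
proof -
  have "cinner (c *\<^sub>C x) (c *\<^sub>C x) = (c * cnj c) * cinner x x"
    by (simp add: cinner_scaleC_left cinner_scaleC_right)
  then have "complex_of_real ((norm (c *\<^sub>C x))\<^sup>2) = of_real ((cmod c * norm x)\<^sup>2)"
    by (simp only: cinner_self complex_norm_square[symmetric] of_real_mult[symmetric] power_mult_distrib)
  then show ?thesis
    by (simp only: of_real_eq_iff) (simp add: power2_eq_iff_nonneg)
qed

lemma cinner_Cauchy_Schwarz: "cmod (cinner x y) \<le> norm x * norm y"
proof (cases "cinner x y = 0")
  case False
  define c where "c = cnj (cinner x y) / cmod (cinner x y)"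
  have c: "cmod c = 1"
    using False by (simp add: c_def norm_divide)
  have "c * cinner x y = cmod (cinner x y)"
    using False by (simp add: c_def field_simps complex_norm_square power2_eq_square)
      (metis complex_norm_square mult.commute of_real_mult power2_eq_square)
  then have "cmod (cinner x y) = Re (cinner (c *\<^sub>C x) y)"
    by (simp add: cinner_scaleC_left)
  also have "\<dots> \<le> norm (c *\<^sub>C x) * norm y"
    by (metis inner_eq_Re_cinner norm_cauchy_schwarz)
  finally show ?thesis
    by (simp add: norm_scaleC c)
qed simp

lemma cinner_ext: "(\<And>y. cinner y a = cinner y b) \<Longrightarrow> a = b"
proof -
  assume *: "\<And>y. cinner y a = cinner y b"
  have "cinner (a - b) (a - b) = 0"
    using *[of "a - b"] by (simp add: cinner_diff_right)
  then show "a = b"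
    by (simp add: cinner_self)
qed

lemma scaleC_zero_right [simp]: "c *\<^sub>C 0 = (0::'a::complex_inner)"
  using norm_scaleC[of c "0::'a"] by simp

lemma bounded_bilinear_cinner: "bounded_bilinear cinner"
proof
  show "\<exists>K. \<forall>a b. cmod (cinner a b) \<le> norm a * norm b * K"
    by (intro exI[of _ 1]) (simp add: cinner_Cauchy_Schwarz)
qed (simp_all add: cinner_add_left cinner_add_right cinner_scaleR scaleR_conv_of_real)

lemmas tendsto_cinner = bounded_bilinear.tendsto[OF bounded_bilinear_cinner]

text \<open>
  A complex-linear functional is determined by its real part: its imaginary part at \<open>x\<close> is minus the real
  part at \<open>\<i> x\<close>.
\<close>

lemma cinner_eqI_Re:
  assumes "\<And>c x. T (c *\<^sub>C x) = c *\<^sub>C T x" "\<And>c x. G (c *\<^sub>C x) = c *\<^sub>C G x"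
    and "\<And>x. Re (cinner (G x) y) = Re (cinner (T x) z)"
  shows "cinner (G x) y = cinner (T x) z"
  using assms(3)[of x] assms(3)[of "\<i> *\<^sub>C x"]
  by (simp add: assms(1,2) cinner_scaleC_left complex_eq_iff)

lemma whole_simps [simp]: "carr whole = UNIV" "ip whole = cinner"
  by (simp_all add: whole_def sub_space_def)

lemma sub_space_simps [simp]: "carr (sub_space M) = M" "ip (sub_space M) = cinner"
  by (simp_all add: sub_space_def)

lemma hnorm_sub_space [simp]: "hnorm (sub_space M) x = norm x"
  by (simp add: hnorm_def norm_eq_sqrt_inner inner_eq_Re_cinner)

lemma bops_whole_iff:
  "T \<in> bops whole whole \<longleftrightarrow> (\<forall>x y. T (x + y) = T x + T y) \<and> (\<forall>c x. T (c *\<^sub>C x) = c *\<^sub>C T x) \<and>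
     (\<exists>B. \<forall>x. norm (T x) \<le> B * norm x)"
  by (auto simp: bops_def hnorm_whole)

lemma bops_wholeI:
  assumes "\<And>x y. T (x + y) = T x + T y" "\<And>c x. T (c *\<^sub>C x) = c *\<^sub>C T x"
    "\<And>x. norm (T x) \<le> B * norm x"
  shows "T \<in> bops whole whole"
  using assms by (auto simp: bops_whole_iff)

lemma bops_scaleC: "T \<in> bops whole whole \<Longrightarrow> T (c *\<^sub>C x) = c *\<^sub>C T x"
  by (simp add: bops_whole_iff)

lemma bops_bounded_linear:
  assumes "T \<in> bops whole whole"
  shows "bounded_linear T"
proof -
  obtain B where B: "\<And>x. norm (T x) \<le> B * norm x"
    using assms by (auto simp: bops_whole_iff)
  show ?thesis
  proof (rule bounded_linear_intro)
    show "norm (T x) \<le> norm x * B" for x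
      using B[of x] by (simp add: mult.commute)
  qed (use assms in \<open>auto simp: bops_whole_iff scaleR_scaleC\<close>)
qed

lemmas bops_linear = bounded_linear.linear[OF bops_bounded_linear]
lemmas bops_add = linear_add[OF bops_linear]
lemmas bops_diff = linear_diff[OF bops_linear]
lemmas bops_zero = linear_0[OF bops_linear]
lemmas bops_scaleR = linear_scale[OF bops_linear]

lemma bops_pos_bound:
  assumes "T \<in> bops whole whole"
  obtains B where "B > 0" "\<And>x. norm (T x) \<le> B * norm x"
  using bounded_linear.pos_bounded[OF bops_bounded_linear[OF assms]] by (metis mult.commute)

lemma bops_bounded_linearI:
  assumes "bounded_linear T" "\<And>c x. T (c *\<^sub>C x) = c *\<^sub>C T x"
  shows "T \<in> bops whole whole"
  using assms bounded_linear.bounded[OF assms(1)]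
  by (auto simp: bops_whole_iff linear_add bounded_linear.linear mult.commute)

lemma bops_comp:
  assumes "T \<in> bops whole whole" "R \<in> bops whole whole"
  shows "(\<lambda>x. T (R x)) \<in> bops whole whole"
  by (rule bops_bounded_linearI[OF bounded_linear_compose[OF assms[THEN bops_bounded_linear]]])
    (simp add: assms bops_scaleC)

lemma bops_minus:
  assumes "T \<in> bops whole whole" "R \<in> bops whole whole"
  shows "(\<lambda>x. T x - R x) \<in> bops whole whole"
  by (rule bops_bounded_linearI[OF bounded_linear_sub[OF assms[THEN bops_bounded_linear]]])
    (simp add: assms bops_scaleC scaleC_diff_right)

lemma bops_ident: "(\<lambda>x. x) \<in> bops whole whole"
  by (rule bops_bounded_linearI) auto

lemma bops_scaleR_fun:
  assumes "T \<in> bops whole whole"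
  shows "(\<lambda>x. r *\<^sub>R T x) \<in> bops whole whole"
  by (rule bops_bounded_linearI[OF bounded_linear_scaleR_right[THEN bounded_linear_compose, OF bops_bounded_linear[OF assms]]])
    (simp add: assms bops_scaleC scaleC_scaleR)

section \<open>Representation of dominated functionals, and adjoints\<close>

lemma nonneg_quadratic_imp_zero:
  fixes a b :: real
  assumes "\<And>t. 0 \<le> t\<^sup>2 * a + 2 * t * b"
  shows "b = 0"
proof (rule ccontr)
  assume b: "b \<noteq> 0"
  define d where "d = \<bar>a\<bar> + 1"
  have d: "0 < d" "a < 2 * d"
    by (auto simp: d_def)
  (* For small t of the sign opposite to b the linear term dominates; t = - b / d is small enough. *)
  have "0 \<le> (- b / d)\<^sup>2 * a + 2 * (- b / d) * b"
    by (rule assms)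
  also have "\<dots> = (b\<^sup>2 / d\<^sup>2) * (a - 2 * d)"
    using d by (simp add: field_simps power2_eq_square)
  also have "\<dots> < 0"
    using b d by (intro mult_pos_neg divide_pos_pos) auto
  finally show False by simp
qed

text \<open>
  The vector \<open>z\<close> is the limit of \<open>S (w n)\<close> for a sequence \<open>w\<close> that minimises \<open>\<parallel>S y\<parallel>\<^sup>2 - 2 \<phi> y\<close>. The
  parallelogram law makes \<open>S (w n)\<close> a Cauchy sequence, and stationarity of the minimum in the
  direction of \<open>y\<close> gives the representation. Dominating \<open>\<phi>\<close> through \<open>S\<close> is what makes the statement
  cover Douglas' lemma as well as the Riesz representation theorem.
\<close>

lemma real_riesz_range:
  fixes S :: "'a::real_vector \<Rightarrow> 'b::{real_inner,complete_space}" and \<phi> :: "'a \<Rightarrow> real"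
  assumes S: "linear S" and \<phi>: "linear \<phi>" and C: "0 \<le> C" and bound: "\<And>y. \<bar>\<phi> y\<bar> \<le> C * norm (S y)"
  shows "\<exists>z\<in>closure (range S). norm z \<le> C \<and> (\<forall>y. \<phi> y = inner (S y) z)"
proof -
  define J where "J y = (norm (S y))\<^sup>2 - 2 * \<phi> y" for y
  have J_ge: "- C\<^sup>2 \<le> J y" for y
  proof -
    have "0 \<le> (norm (S y) - C)\<^sup>2" by simp
    then show ?thesis
      using bound[of y] by (simp add: J_def power2_diff) argo
  qed
  define m where "m = (INF y. J y)"
  have bdd: "bdd_below (range J)"
    using J_ge by (auto simp: bdd_below_def)
  have m_le: "m \<le> J y" for y
    unfolding m_def by (rule cINF_lower[OF bdd]) simp
  have "\<exists>y. J y < m + 1 / Suc n" for n :: nat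
    using cINF_less_iff[OF _ bdd, of "m + 1 / Suc n"] by (auto simp: m_def)
  then obtain w where w: "\<And>n::nat. J (w n) < m + 1 / Suc n"
    by metis
  have gap: "(norm (S a - S b))\<^sup>2 \<le> 2 * (J a - m) + 2 * (J b - m)" for a b
  proof -
    (* The midpoint of two almost minimal points cannot lie below the infimum. *)
    have "4 * m \<le> 4 * J ((1/2) *\<^sub>R (a + b))"
      using m_le by simp
    also have "\<dots> = (norm (S a + S b))\<^sup>2 - 4 * (\<phi> a + \<phi> b)"
      by (simp add: J_def linear_scale[OF S] linear_scale[OF \<phi>] linear_add[OF S] linear_add[OF \<phi>]
          power2_norm_eq_inner inner_simps inner_commute field_simps)
    finally show ?thesis
      by (simp add: J_def power2_norm_eq_inner inner_simps inner_commute)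
  qed
  have "Cauchy (\<lambda>n. S (w n))"
  proof (rule metric_CauchyI)
    fix e :: real assume e: "0 < e"
    obtain N :: nat where N: "4 / e\<^sup>2 < N"
      using reals_Archimedean2 by blast
    have "dist (S (w i)) (S (w j)) < e" if "i \<ge> N" "j \<ge> N" for i j
    proof -
      have le: "J (w k) < m + e\<^sup>2 / 4" if "k \<ge> N" for k
      proof -
        have "4 / e\<^sup>2 < Suc k" using N that by linarith
        then have "1 / Suc k < e\<^sup>2 / 4" using e by (simp add: field_simps)
        then show ?thesis using w[of k] by (meson add_strict_left_mono order_less_trans)
      qed
      have "(norm (S (w i) - S (w j)))\<^sup>2 < e\<^sup>2"
        by (rule order.strict_trans1[OF gap]) (use le[OF that(1)] le[OF that(2)] in argo)
      then show ?thesis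
        using e by (simp add: dist_norm power2_less_imp_less)
    qed
    then show "\<exists>M. \<forall>m\<ge>M. \<forall>n\<ge>M. dist (S (w m)) (S (w n)) < e" by blast
  qed
  then obtain z where z: "(\<lambda>n. S (w n)) \<longlonglongrightarrow> z"
    using Cauchy_convergent convergent_def by blast
  have zc: "z \<in> closure (range S)"
    unfolding closure_sequential by (rule exI[of _ "\<lambda>n. S (w n)"]) (use z in simp)
  have eq: "\<phi> y = inner (S y) z" for y
  proof -
    have "0 \<le> t\<^sup>2 * (norm (S y))\<^sup>2 + 2 * t * (inner (S y) z - \<phi> y)" for t
    proof (rule LIMSEQ_le_const)
      show "(\<lambda>n. t\<^sup>2 * (norm (S y))\<^sup>2 + 2 * t * (inner (S y) (S (w n)) - \<phi> y) + 1 / Suc n) \<longlonglongrightarrow>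
          t\<^sup>2 * (norm (S y))\<^sup>2 + 2 * t * (inner (S y) z - \<phi> y)"
        using tendsto_add[OF tendsto_add[OF tendsto_const tendsto_mult[OF tendsto_const
              tendsto_diff[OF tendsto_inner[OF tendsto_const z] tendsto_const]]] LIMSEQ_Suc[OF lim_1_over_n]]
        by simp
      have "0 \<le> t\<^sup>2 * (norm (S y))\<^sup>2 + 2 * t * (inner (S y) (S (w n)) - \<phi> y) + 1 / Suc n" for n
      proof -
        have "J (w n + t *\<^sub>R y) = J (w n) + t\<^sup>2 * (norm (S y))\<^sup>2 + 2 * t * (inner (S y) (S (w n)) - \<phi> y)"
          by (simp add: J_def linear_scale[OF S] linear_scale[OF \<phi>] linear_add[OF S] linear_add[OF \<phi>]
              power2_norm_eq_inner inner_simps inner_commute power2_eq_square[of t] algebra_simps)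
        then show ?thesis
          using m_le[of "w n + t *\<^sub>R y"] w[of n] by linarith
      qed
      then show "\<exists>N. \<forall>n\<ge>N. 0 \<le> t\<^sup>2 * (norm (S y))\<^sup>2 + 2 * t * (inner (S y) (S (w n)) - \<phi> y) + 1 / Suc n"
        by blast
    qed
    then show ?thesis
      using nonneg_quadratic_imp_zero[of "(norm (S y))\<^sup>2" "inner (S y) z - \<phi> y"] by simp
  qed
  have "norm z \<le> C"
  proof -
    have "inner z z \<le> C * norm z"
    proof (rule LIMSEQ_le)
      show "(\<lambda>n. inner (S (w n)) z) \<longlonglongrightarrow> inner z z"
        by (intro tendsto_inner z tendsto_const)
      show "(\<lambda>n. C * norm (S (w n))) \<longlonglongrightarrow> C * norm z"
        by (intro tendsto_mult tendsto_norm z tendsto_const)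
      show "\<exists>N. \<forall>n\<ge>N. inner (S (w n)) z \<le> C * norm (S (w n))"
        using bound eq by (metis abs_le_D1)
    qed
    then show ?thesis
      using C by (cases "z = 0") (auto simp: power2_eq_square simp flip: power2_norm_eq_inner)
  qed
  then show ?thesis
    using zc eq by blast
qed

text \<open>
  For \<open>T\<close> the identity this is the Riesz representation of the functional \<open>\<langle>G x, y\<rangle>\<close>, hence the
  existence of the adjoint of \<open>G\<close>; for \<open>G\<close> the identity it is Douglas' lemma for a vector.
\<close>

lemma riesz_range:
  fixes T :: "'a::complex_inner \<Rightarrow> 'b::chilbert_space" and G :: "'a \<Rightarrow> 'c::complex_inner"
  assumes T: "T \<in> bops whole whole" and G: "G \<in> bops whole whole" and C: "0 \<le> C"
    and bound: "\<And>x. cmod (cinner (G x) y) \<le> C * norm (T x)"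
  shows "\<exists>z\<in>closure (range T). norm z \<le> C \<and> (\<forall>x. cinner (G x) y = cinner (T x) z)"
proof -
  have "linear (\<lambda>x. Re (cinner (G x) y))"
    by (rule linearI) (simp_all add: bops_add[OF G] bops_scaleR[OF G] cinner_add_left cinner_scaleR)
  moreover have "\<bar>Re (cinner (G x) y)\<bar> \<le> C * norm (T x)" for x
    using bound[of x] abs_Re_le_cmod[of "cinner (G x) y"] by linarith
  ultimately obtain z where z: "z \<in> closure (range T)" "norm z \<le> C"
    "\<And>x. Re (cinner (G x) y) = inner (T x) z"
    using real_riesz_range[OF bops_linear[OF T] _ C, of "\<lambda>x. Re (cinner (G x) y)"] by blast
  have "cinner (G x) y = cinner (T x) z" for x
    by (rule cinner_eqI_Re) (use z(3) in \<open>simp_all add: T G bops_scaleC inner_eq_Re_cinner\<close>)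
  then show ?thesis
    using z by blast
qed

text \<open>
  The last assumption expresses that the inner product of \<open>H\<close> is nondegenerate, which makes the
  description of the adjoint determinate.
\<close>

lemma adj_eqI:
  assumes "y \<in> carr K" "z \<in> carr H" "\<And>x. x \<in> carr H \<Longrightarrow> ip K (F x) y = ip H x z"
    and "\<And>z'. z' \<in> carr H \<Longrightarrow> \<forall>x\<in>carr H. ip H x z' = ip H x z \<Longrightarrow> z' = z"
  shows "adj H K F y = z"
proof -
  have "(THE z. z \<in> carr H \<and> (\<forall>x\<in>carr H. ip K (F x) y = ip H x z)) = z"
  proof (rule the_equality)
    show "z \<in> carr H \<and> (\<forall>x\<in>carr H. ip K (F x) y = ip H x z)"
      using assms(2,3) by blast
    fix z' assume z': "z' \<in> carr H \<and> (\<forall>x\<in>carr H. ip K (F x) y = ip H x z')"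
    show "z' = z"
    proof (rule assms(4))
      show "\<forall>x\<in>carr H. ip H x z' = ip H x z"
        using z' assms(3) by metis
    qed (use z' in blast)
  qed
  then show ?thesis
    using assms(1) by (simp add: adj_def)
qed

lemma cinner_adj:
  fixes T :: "'a::chilbert_space \<Rightarrow> 'b::complex_inner"
  assumes T: "T \<in> bops whole whole"
  shows "cinner (T x) y = cinner x (adj whole whole T y)"
proof -
  obtain B where B: "B > 0" "\<And>x. norm (T x) \<le> B * norm x"
    using bops_pos_bound[OF T] by blast
  have "cmod (cinner (T x) y) \<le> B * norm y * norm x" for x
    using order_trans[OF cinner_Cauchy_Schwarz mult_right_mono[OF B(2) norm_ge_zero], of x y]
    by (simp add: mult_ac)
  then obtain z where z: "\<And>x. cinner (T x) y = cinner x z"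
    using riesz_range[OF bops_ident T, of "B * norm y" y] B(1) by auto
  have "adj whole whole T y = z"
    by (rule adj_eqI) (auto simp: z intro: cinner_ext)
  then show ?thesis
    by (simp add: z)
qed

text \<open>
  Linearity of \<open>R\<close> follows from that of the inner product, and \<open>\<parallel>R y\<parallel>\<^sup>2 = \<langle>T R y, y\<rangle>\<close> bounds \<open>\<parallel>R y\<parallel>\<close>.
\<close>

lemma bops_adjointI:
  assumes T: "T \<in> bops whole whole" and adj: "\<And>x y. cinner (T x) y = cinner x (R y)"
  shows "R \<in> bops whole whole"
proof -
  obtain B where B: "B > 0" "\<And>x. norm (T x) \<le> B * norm x"
    using bops_pos_bound[OF T] by blast
  show ?thesis
  proof (rule bops_wholeI)
    show "R (x + y) = R x + R y" for x y
      by (rule cinner_ext) (simp add: adj[symmetric] cinner_add_right)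
    show "R (c *\<^sub>C x) = c *\<^sub>C R x" for c x
      by (rule cinner_ext) (simp add: adj[symmetric] cinner_scaleC_right)
    show "norm (R y) \<le> B * norm y" for y
    proof (cases "R y = 0")
      case False
      have "(norm (R y))\<^sup>2 = cmod (cinner (T (R y)) y)"
        by (simp add: adj cinner_self norm_power)
      also have "\<dots> \<le> norm (R y) * (B * norm y)"
        using order_trans[OF cinner_Cauchy_Schwarz mult_right_mono[OF B(2) norm_ge_zero], of "R y" y]
        by (simp add: mult_ac)
      finally show ?thesis
        using False by (simp add: power2_eq_square)
    qed (use B in simp)
  qed
qed

lemma bops_adj:
  fixes T :: "'a::chilbert_space \<Rightarrow> 'b::complex_inner"
  shows "T \<in> bops whole whole \<Longrightarrow> adj whole whole T \<in> bops whole whole"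
  by (rule bops_adjointI) (auto simp: cinner_adj)

section \<open>Positive operators and their square roots\<close>

lemma psd_bops: "psd whole P \<Longrightarrow> P \<in> bops whole whole"
  by (simp add: psd_def)

lemma psd_ge: "psd whole P \<Longrightarrow> 0 \<le> Re (cinner (P x) x)"
  by (simp add: psd_def)

text \<open>
  Polarisation: the quadratic form is real at \<open>x + y\<close> and at \<open>x + \<i> y\<close>.
\<close>

lemma psd_sym:
  fixes P :: "'a::complex_inner \<Rightarrow> 'a"
  assumes P: "psd whole P"
  shows "cinner (P x) y = cinner x (P y)"
proof -
  note B = psd_bops[OF P]
  have im: "Im (cinner (P z) z) = 0" for z
    using P by (simp add: psd_def complex_is_Real_iff)
  have "Im (cinner (P x) y) + Im (cinner (P y) x) = 0"
    using im[of "x + y"] im[of x] im[of y]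
    by (simp add: bops_add[OF B] cinner_add_left cinner_add_right)
  moreover have "Re (cinner (P y) x) - Re (cinner (P x) y) = 0"
    using im[of "x + \<i> *\<^sub>C y"] im[of x] im[of y]
    by (simp add: bops_add[OF B] bops_scaleC[OF B] cinner_add_left cinner_add_right
        cinner_scaleC_left cinner_scaleC_right)
  ultimately have "cinner (P x) y = cnj (cinner (P y) x)"
    by (simp add: complex_eq_iff)
  then show ?thesis
    by (simp add: cinner_commute[of x])
qed

lemma psd_wholeI:
  assumes P: "P \<in> bops whole whole" and sym: "\<And>x y. cinner (P x) y = cinner x (P y)"
    and ge: "\<And>x. 0 \<le> Re (cinner (P x) x)"
  shows "psd whole P"
proof -
  have "cinner (P x) x \<in> \<real>" for x
    by (metis Reals_cnj_iff cinner_commute sym)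
  then show ?thesis
    using P ge by (simp add: psd_def)
qed

lemma psd_Cauchy_Schwarz:
  fixes P :: "'a::complex_inner \<Rightarrow> 'a"
  assumes P: "psd whole P"
  shows "(Re (cinner (P x) y))\<^sup>2 \<le> Re (cinner (P x) x) * Re (cinner (P y) y)"
proof -
  note B = psd_bops[OF P]
  define a b d where "a = Re (cinner (P x) x)" and "b = Re (cinner (P x) y)" and "d = Re (cinner (P y) y)"
  have yx: "Re (cinner (P y) x) = b"
    by (metis b_def psd_sym[OF P] cinner_commute complex_cnj_cnj cnj.simps(1))
  have quad: "0 \<le> s\<^sup>2 * a + 2 * s * t * b + t\<^sup>2 * d" for s t :: real
    using psd_ge[OF P, of "s *\<^sub>R x + t *\<^sub>R y"] yx
    by (simp add: bops_add[OF B] bops_scaleR[OF B] cinner_add_left cinner_add_right cinner_scaleR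
        a_def b_def d_def power2_eq_square algebra_simps)
  have a: "0 \<le> a" and d: "0 \<le> d"
    using psd_ge[OF P] by (auto simp: a_def d_def)
  have "b\<^sup>2 \<le> a * d"
  proof (cases "a = 0")
    case True
    have "0 \<le> t\<^sup>2 * d + 2 * t * b" for t
      using quad[of 1 t] True by simp
    then show ?thesis
      using nonneg_quadratic_imp_zero[of d b] True by simp
  next
    case False
    (* The form is nonnegative at a y - b x, where it equals a (a d - b^2). *)
    have "0 \<le> a * (a * d - b\<^sup>2)"
      using quad[of "- b" a] by (simp add: power2_eq_square algebra_simps)
    then show ?thesis
      using a False by (simp add: zero_le_mult_iff)
  qed
  then show ?thesis
    by (simp add: a_def b_def d_def)
qed

text \<open>
  By the Cauchy--Schwarz inequality of the form \<open>\<langle>P x, y\<rangle>\<close> at \<open>y = P x\<close>.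
\<close>

lemma psd_zeroI:
  assumes P: "psd whole P" and "Re (cinner (P x) x) = 0"
  shows "P x = 0"
proof -
  have "(Re (cinner (P x) (P x)))\<^sup>2 \<le> 0"
    using psd_Cauchy_Schwarz[OF P, of x "P x"] assms(2) by simp
  then show ?thesis
    by (simp add: cinner_self)
qed

text \<open>
  Since \<open>R\<close> and \<open>R'\<close> commute, \<open>(R + R') (R - R') = R\<^sup>2 - R'\<^sup>2 = 0\<close>. For \<open>y = (R - R') x\<close> positivity
  then forces \<open>R y = R' y = 0\<close>, and \<open>\<parallel>y\<parallel>\<^sup>2 = \<langle>x, (R - R') y\<rangle> = 0\<close>.
\<close>

lemma psd_sqrt_unique:
  assumes R: "psd whole R" and R': "psd whole R'"
    and eq: "\<And>x. R (R x) = R' (R' x)" and comm: "\<And>x. R (R' x) = R' (R x)"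
  shows "R = R'"
proof
  fix x
  note B = psd_bops[OF R] psd_bops[OF R']
  define y where "y = R x - R' x"
  have "R y + R' y = 0"
    by (simp add: y_def B bops_diff eq comm)
  then have "Re (cinner (R y) y) + Re (cinner (R' y) y) = 0"
    by (simp flip: plus_complex.sel cinner_add_left)
  then have "Re (cinner (R y) y) = 0" "Re (cinner (R' y) y) = 0"
    using psd_ge[OF R, of y] psd_ge[OF R', of y] by linarith+
  then have "R y = 0" "R' y = 0"
    using R R' psd_zeroI by blast+
  moreover have "cinner y y = cinner x (R y) - cinner x (R' y)"
    by (simp add: y_def cinner_diff_left psd_sym[OF R] psd_sym[OF R'])
  ultimately have "cinner y y = 0"
    by simp
  then show "R x = R' x"
    by (simp add: cinner_self y_def)
qed

text \<open>
  The operator \<open>R = I - Z\<close> is a square root of \<open>I - B\<close> if \<open>Z = (B + Z\<^sup>2) / 2\<close>. The iteration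
  \<open>Y\<^sub>0 = 0\<close>, \<open>Y\<^sub>n\<^sub>+\<^sub>1 = (B + Y\<^sub>n\<^sup>2) / 2\<close> converges to such a \<open>Z\<close> because it is dominated by the scalar iteration
  \<open>s\<^sub>0 = 0\<close>, \<open>s\<^sub>n\<^sub>+\<^sub>1 = (1 + s\<^sub>n\<^sup>2) / 2\<close>, which increases and is bounded by 1: one has
  \<open>\<parallel>Y\<^sub>n\<parallel> \<le> s\<^sub>n\<close> and \<open>\<parallel>Y\<^sub>n\<^sub>+\<^sub>1 - Y\<^sub>n\<parallel> \<le> s\<^sub>n\<^sub>+\<^sub>1 - s\<^sub>n\<close>. Each \<open>Y\<^sub>n\<close> is a polynomial in \<open>B\<close>, whence the last claim.
\<close>

lemma sqrt_of_id_minus: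
  fixes B :: "'a::chilbert_space \<Rightarrow> 'a"
  assumes B: "B \<in> bops whole whole" and sym: "\<And>x y. cinner (B x) y = cinner x (B y)"
    and le: "\<And>x. norm (B x) \<le> norm x"
  shows "\<exists>R. psd whole R \<and> (\<forall>x. R (R x) = x - B x) \<and>
    (\<forall>K. K \<in> bops whole whole \<and> (\<forall>x. K (B x) = B (K x)) \<longrightarrow> (\<forall>x. K (R x) = R (K x)))"
proof -
  define Y where "Y = rec_nat (\<lambda>x. 0) (\<lambda>_ f x. (1/2) *\<^sub>R (B x + f (f x)))"
  define s :: "nat \<Rightarrow> real" where "s = rec_nat 0 (\<lambda>_ t. (1 + t\<^sup>2) / 2)"
  have Y0: "Y 0 x = 0" and YS: "Y (Suc n) x = (1/2) *\<^sub>R (B x + Y n (Y n x))" for n x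
    by (simp_all add: Y_def)
  have s0: "s 0 = 0" and sS: "s (Suc n) = (1 + (s n)\<^sup>2) / 2" for n
    by (simp_all add: s_def)
  have Y: "Y n \<in> bops whole whole" for n
  proof (induction n)
    case 0
    then show ?case
      by (intro bops_wholeI[of _ 0]) (simp_all add: Y0)
  next
    case (Suc n)
    have "bounded_linear (\<lambda>x. (1/2) *\<^sub>R (B x + Y n (Y n x)))"
      by (rule bounded_linear_compose[OF bounded_linear_scaleR_right
            bounded_linear_add[OF bops_bounded_linear[OF B] bops_bounded_linear[OF bops_comp[OF Suc Suc]]]])
    then have "bounded_linear (Y (Suc n))"
      by (simp add: YS[abs_def])
    then show ?case
      by (rule bops_bounded_linearI) (simp add: YS bops_scaleC[OF B] bops_scaleC[OF Suc] scaleC_scaleR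
          scaleC_add_right)
  qed
  have Ysym: "cinner (Y n x) y = cinner x (Y n y)" for n x y
    by (induction n arbitrary: x y)
      (simp_all add: Y0 YS cinner_scaleR cinner_add_left cinner_add_right sym)
  have s: "0 \<le> s n \<and> s n \<le> 1" for n
    by (induction n) (simp_all add: s0 sS power_le_one)
  have Ys: "norm (Y n x) \<le> s n * norm x" for n x
  proof (induction n arbitrary: x)
    case (Suc n)
    have "norm (Y n (Y n x)) \<le> s n * (s n * norm x)"
      using Suc[of "Y n x"] mult_left_mono[OF Suc[of x], of "s n"] s[of n] by linarith
    then have "norm (B x + Y n (Y n x)) \<le> norm x + (s n)\<^sup>2 * norm x"
      using norm_triangle_ineq[of "B x" "Y n (Y n x)"] le[of x] by (simp add: power2_eq_square)
    moreover have "norm (Y (Suc n) x) = norm (B x + Y n (Y n x)) / 2"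
      unfolding YS norm_scaleR by simp
    ultimately show ?case
      by (simp add: sS algebra_simps)
  qed (simp add: Y0 s0)
  have s_inc: "s n \<le> s (Suc n)" for n
  proof -
    have "0 \<le> (1 - s n)\<^sup>2" by simp
    then show ?thesis by (simp add: sS power2_diff)
  qed
  have step: "norm (Y (Suc n) x - Y n x) \<le> (s (Suc n) - s n) * norm x" for n x
  proof (induction n arbitrary: x)
    case 0
    then show ?case
      using le by (simp add: YS Y0 sS s0)
  next
    case (Suc n)
    define D where "D z = Y (Suc n) z - Y n z" for z
    have IH: "norm (D z) \<le> (s (Suc n) - s n) * norm z" for z
      using Suc by (simp add: D_def)
    have nn: "0 \<le> s (Suc n) - s n"
      using s_inc[of n] by simp
    (* Y'^2 - Y^2 = Y' (Y' - Y) + (Y' - Y) Y, and D stands for Y' - Y. *)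
    have "Y (Suc (Suc n)) x - Y (Suc n) x = (1/2) *\<^sub>R (Y (Suc n) (D x) + D (Y n x))"
    proof -
      have "Y (Suc (Suc n)) x - Y (Suc n) x
          = (1/2) *\<^sub>R ((B x + Y (Suc n) (Y (Suc n) x)) - (B x + Y n (Y n x)))"
        by (simp only: scaleR_diff_right YS[symmetric])
      then show ?thesis
        by (simp add: D_def bops_diff[OF Y])
    qed
    moreover have "norm (Y (Suc n) (D x)) \<le> s (Suc n) * ((s (Suc n) - s n) * norm x)"
      using order_trans[OF Ys mult_left_mono[OF IH]] s by blast
    moreover have "norm (D (Y n x)) \<le> (s (Suc n) - s n) * (s n * norm x)"
      using order_trans[OF IH mult_left_mono[OF Ys]] nn by blast
    moreover note norm_triangle_ineq[of "Y (Suc n) (D x)" "D (Y n x)"]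
    ultimately have "norm (Y (Suc (Suc n)) x - Y (Suc n) x)
        \<le> (s (Suc n) * ((s (Suc n) - s n) * norm x) + (s (Suc n) - s n) * (s n * norm x)) / 2"
      by simp
    also have "\<dots> = (((s (Suc n))\<^sup>2 - (s n)\<^sup>2) / 2) * norm x"
      by (simp add: power2_eq_square algebra_simps)
    also have "((s (Suc n))\<^sup>2 - (s n)\<^sup>2) / 2 = s (Suc (Suc n)) - s (Suc n)"
      unfolding sS[of "Suc n"] by (subst (3) sS) (simp add: field_simps)
    finally show ?case .
  qed
  have "Cauchy s"
  proof -
    have "incseq s" using s_inc by (rule incseq_SucI)
    moreover have "Bseq s" using s by (intro BseqI'[of _ 1]) simp
    ultimately show ?thesis
      using Bseq_monoseq_convergent convergent_Cauchy incseq_imp_monoseq by blast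
  qed
  have diff: "norm (Y (n + k) x - Y n x) \<le> (s (n + k) - s n) * norm x" for n k x
  proof (induction k)
    case (Suc k)
    have "norm (Y (n + Suc k) x - Y n x) \<le> norm (Y (Suc (n + k)) x - Y (n + k) x) + norm (Y (n + k) x - Y n x)"
      using norm_triangle_ineq[of "Y (Suc (n + k)) x - Y (n + k) x" "Y (n + k) x - Y n x"] by simp
    then show ?case
      using step[of "n + k" x] Suc by (simp add: algebra_simps)
  qed simp
  have "Cauchy (\<lambda>n. Y n x)" for x
  proof (rule metric_CauchyI)
    fix e :: real assume e: "0 < e"
    then have "0 < e / (norm x + 1)"
      by (simp add: add_nonneg_pos)
    then obtain N where N: "\<And>i j. i \<ge> N \<Longrightarrow> j \<ge> N \<Longrightarrow> dist (s i) (s j) < e / (norm x + 1)"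
      using metric_CauchyD[OF \<open>Cauchy s\<close>] by blast
    have *: "dist (Y i x) (Y j x) < e" if "N \<le> j" "j \<le> i" for i j
    proof -
      have "dist (Y i x) (Y j x) \<le> (s i - s j) * norm x"
        using diff[of j "i - j" x] that by (simp add: dist_norm)
      also have "\<dots> \<le> dist (s i) (s j) * (norm x + 1)"
        by (intro mult_mono) (auto simp: dist_real_def)
      also have "\<dots> < e"
        using N[of i j] that by (simp add: pos_less_divide_eq add_nonneg_pos)
      finally show ?thesis .
    qed
    show "\<exists>M. \<forall>m\<ge>M. \<forall>n\<ge>M. dist (Y m x) (Y n x) < e"
      using * by (metis dist_commute nle_le)
  qed
  then have "\<exists>z. (\<lambda>n. Y n x) \<longlonglongrightarrow> z" for x
    using Cauchy_convergent[of "\<lambda>n. Y n x"] by (simp add: convergent_def)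
  then obtain Z where Z: "\<And>x. (\<lambda>n. Y n x) \<longlonglongrightarrow> Z x"
    by metis
  have Yle: "norm (Y n x) \<le> norm x" for n x
    using Ys[of n x] mult_right_mono[of "s n" 1 "norm x"] s[of n] by simp
  then have Zle: "norm (Z x) \<le> norm x" for x
    by (intro LIMSEQ_le_const2[OF tendsto_norm[OF Z]]) blast
  have Zsym: "cinner (Z x) y = cinner x (Z y)" for x y
  proof (rule LIMSEQ_unique)
    show "(\<lambda>n. cinner (Y n x) y) \<longlonglongrightarrow> cinner (Z x) y"
      by (rule tendsto_cinner[OF Z tendsto_const])
    show "(\<lambda>n. cinner (Y n x) y) \<longlonglongrightarrow> cinner x (Z y)"
      unfolding Ysym by (rule tendsto_cinner[OF tendsto_const Z])
  qed
  have Zb: "Z \<in> bops whole whole"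
  proof (rule bops_wholeI[of _ 1])
    show "Z (x + y) = Z x + Z y" for x y
      by (rule cinner_ext) (simp add: Zsym[symmetric] cinner_add_right)
    show "Z (c *\<^sub>C x) = c *\<^sub>C Z x" for c x
      by (rule cinner_ext) (simp add: Zsym[symmetric] cinner_scaleC_right)
  qed (simp add: Zle)
  have YZ: "(\<lambda>n. Y n (Y n x)) \<longlonglongrightarrow> Z (Z x)" for x
  proof -
    (* The operators Y n are bounded by 1 uniformly in n. *)
    have "(\<lambda>n. Y n (Y n x - Z x)) \<longlonglongrightarrow> 0"
      by (rule tendsto_0_le[where K = 1 and f = "\<lambda>n. Y n x - Z x"])
        (use Z[of x] Yle in \<open>simp_all add: LIM_zero\<close>)
    from tendsto_add[OF this Z[of "Z x"]] show ?thesis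
      by (simp add: bops_diff[OF Y])
  qed
  have fixp: "2 *\<^sub>R Z x = B x + Z (Z x)" for x
  proof -
    have "(\<lambda>n. (1/2) *\<^sub>R (B x + Y n (Y n x))) \<longlonglongrightarrow> (1/2) *\<^sub>R (B x + Z (Z x))"
      by (intro tendsto_intros YZ)
    then have "(\<lambda>n. Y (Suc n) x) \<longlonglongrightarrow> (1/2) *\<^sub>R (B x + Z (Z x))"
      by (simp add: YS)
    then have "Z x = (1/2) *\<^sub>R (B x + Z (Z x))"
      using LIMSEQ_unique LIMSEQ_Suc[OF Z] by blast
    then have "2 *\<^sub>R Z x = 2 *\<^sub>R ((1/2) *\<^sub>R (B x + Z (Z x)))"
      by (rule arg_cong)
    then show ?thesis
      by (simp only: scaleR_scaleR) simp
  qed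
  define R where "R x = x - Z x" for x
  have "R \<in> bops whole whole"
    using bops_minus[OF bops_ident Zb] by (simp add: R_def[abs_def])
  then have "psd whole R"
  proof (rule psd_wholeI)
    show "cinner (R x) y = cinner x (R y)" for x y
      by (simp add: R_def cinner_diff_left cinner_diff_right Zsym)
    show "0 \<le> Re (cinner (R x) x)" for x
    proof -
      have "Re (cinner (Z x) x) \<le> norm (Z x) * norm x"
        using complex_Re_le_cmod cinner_Cauchy_Schwarz order_trans by blast
      also have "\<dots> \<le> norm x * norm x"
        by (intro mult_right_mono Zle) simp
      finally show ?thesis
        by (simp add: R_def cinner_diff_left cinner_self power2_eq_square)
    qed
  qed
  moreover have "R (R x) = x - B x" for x
    using fixp[of x] by (simp add: R_def bops_diff[OF Zb] scaleR_2 algebra_simps)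
  moreover have "K (R x) = R (K x)"
    if K: "K \<in> bops whole whole" and KB: "\<And>x. K (B x) = B (K x)" for K x
  proof -
    have "K (Y n x) = Y n (K x)" for n x
      by (induction n arbitrary: x)
        (simp_all add: Y0 YS bops_zero[OF K] bops_scaleR[OF K] bops_add[OF K] KB)
    then have "(\<lambda>n. Y n (K x)) \<longlonglongrightarrow> K (Z x)"
      using bounded_linear.tendsto[OF bops_bounded_linear[OF K] Z[of x]] by simp
    then have "K (Z x) = Z (K x)"
      using LIMSEQ_unique Z by blast
    then show ?thesis
      by (simp add: R_def bops_diff[OF K])
  qed
  ultimately show ?thesis
    by (intro exI[of _ R]) blast
qed

text \<open>
  The Cauchy--Schwarz inequality of the form \<open>\<langle>P x, y\<rangle>\<close> at \<open>y = P x\<close> gives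
  \<open>\<parallel>P x\<parallel>\<^sup>4 \<le> \<langle>P x, x\<rangle> \<langle>P P x, P x\<rangle> \<le> \<langle>P x, x\<rangle> \<parallel>P x\<parallel>\<^sup>2\<close>.
\<close>

lemma psd_norm_le:
  fixes P :: "'a::complex_inner \<Rightarrow> 'a"
  assumes P: "psd whole P" and le: "\<And>x. norm (P x) \<le> norm x"
  shows "(norm (P x))\<^sup>2 \<le> Re (cinner (P x) x)"
proof (cases "P x = 0")
  case False
  have "Re (cinner (P (P x)) (P x)) \<le> norm (P (P x)) * norm (P x)"
    using complex_Re_le_cmod cinner_Cauchy_Schwarz order_trans by blast
  also have "\<dots> \<le> (norm (P x))\<^sup>2"
    unfolding power2_eq_square by (intro mult_right_mono le) simp
  finally have "((norm (P x))\<^sup>2)\<^sup>2 \<le> Re (cinner (P x) x) * (norm (P x))\<^sup>2"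
    using psd_Cauchy_Schwarz[OF P, of x "P x"] mult_left_mono[OF _ psd_ge[OF P, of x]]
    by (fastforce simp: cinner_self)
  then have "(norm (P x))\<^sup>2 * (norm (P x))\<^sup>2 \<le> Re (cinner (P x) x) * (norm (P x))\<^sup>2"
    by (simp only: power2_eq_square[of "(norm (P x))\<^sup>2"])
  then show ?thesis
    by (rule mult_right_le_imp_le) (use False in simp)
qed (use psd_ge[OF P] in simp)

text \<open>
  After division by a bound \<open>b\<close> of its norm, \<open>P\<close> has the form \<open>I - B\<close> with \<open>\<parallel>B\<parallel> \<le> 1\<close>. The commutation
  property is what compares this square root with any other one.
\<close>

lemma psd_sqrt_exists:
  fixes P :: "'a::chilbert_space \<Rightarrow> 'a"
  assumes P: "psd whole P"
  shows "\<exists>R. psd whole R \<and> (\<forall>x. R (R x) = P x) \<and>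
    (\<forall>K. K \<in> bops whole whole \<and> (\<forall>x. K (P x) = P (K x)) \<longrightarrow> (\<forall>x. K (R x) = R (K x)))"
proof -
  obtain b where b: "b > 0" "\<And>x. norm (P x) \<le> b * norm x"
    using bops_pos_bound[OF psd_bops[OF P]] by blast
  define P' where "P' x = (1/b) *\<^sub>R P x" for x
  have P'b: "P' \<in> bops whole whole"
    using bops_scaleR_fun[OF psd_bops[OF P], of "1/b"] by (simp add: P'_def[abs_def])
  then have P': "psd whole P'"
    by (rule psd_wholeI)
      (use b psd_ge[OF P] in \<open>simp_all add: P'_def cinner_scaleR psd_sym[OF P]\<close>)
  have P'le: "norm (P' x) \<le> norm x" for x
    using b by (simp add: P'_def field_simps)
  define B where "B x = x - P' x" for x
  have Bb: "B \<in> bops whole whole"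
    using bops_minus[OF bops_ident P'b] by (simp add: B_def[abs_def])
  have Ble: "norm (B x) \<le> norm x" for x
  proof (rule power2_le_imp_le)
    have "(norm (B x))\<^sup>2 = (norm x)\<^sup>2 - 2 * Re (cinner (P' x) x) + (norm (P' x))\<^sup>2"
      by (simp add: B_def power2_norm_eq_inner inner_simps inner_commute[of x "P' x"] inner_eq_Re_cinner[of "P' x" x])
    then show "(norm (B x))\<^sup>2 \<le> (norm x)\<^sup>2"
      using psd_norm_le[OF P' P'le, of x] psd_ge[OF P', of x] by linarith
  qed simp
  obtain R where R: "psd whole R" "\<And>x. R (R x) = x - B x"
    and comm: "\<And>K x. K \<in> bops whole whole \<Longrightarrow> (\<And>x. K (B x) = B (K x)) \<Longrightarrow> K (R x) = R (K x)"
    using sqrt_of_id_minus[OF Bb _ Ble]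
    by (auto simp: B_def cinner_diff_left cinner_diff_right psd_sym[OF P'])
  note Rb = psd_bops[OF R(1)]
  define R' where "R' x = sqrt b *\<^sub>R R x" for x
  have "R' \<in> bops whole whole"
    using bops_scaleR_fun[OF Rb] by (simp add: R'_def[abs_def])
  then have "psd whole R'"
    by (rule psd_wholeI)
      (use b psd_ge[OF R(1)] in \<open>simp_all add: R'_def cinner_scaleR psd_sym[OF R(1)]\<close>)
  moreover have "R' (R' x) = P x" for x
    using b by (simp add: R'_def bops_scaleR[OF Rb] R B_def P'_def)
  moreover have "K (R' x) = R' (K x)"
    if K: "K \<in> bops whole whole" and KP: "\<And>x. K (P x) = P (K x)" for K x
    using comm[OF K, of x]
    by (simp add: R'_def B_def P'_def bops_scaleR[OF K] bops_diff[OF K] KP)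
  ultimately show ?thesis
    by (intro exI[of _ R']) blast
qed

text \<open>
  A second root \<open>R'\<close> commutes with \<open>P = R'\<^sup>2\<close>, hence with the root of \<open>psd_sqrt_exists\<close>, and so agrees
  with it.
\<close>

lemma op_sqrt_whole:
  fixes P :: "'a::chilbert_space \<Rightarrow> 'a"
  assumes P: "psd whole P"
  shows "psd whole (op_sqrt whole P)" "op_sqrt whole P (op_sqrt whole P x) = P x"
    and op_sqrt_wholeI: "psd whole R' \<Longrightarrow> (\<And>x. R' (R' x) = P x) \<Longrightarrow> op_sqrt whole P = R'"
proof -
  obtain R where R: "psd whole R" "\<And>x. R (R x) = P x"
    and comm: "\<And>K x. K \<in> bops whole whole \<Longrightarrow> (\<And>x. K (P x) = P (K x)) \<Longrightarrow> K (R x) = R (K x)"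
    using psd_sqrt_exists[OF P] by blast
  have uniq: "K = R" if K: "psd whole K" "\<And>x. K (K x) = P x" for K
  proof (rule psd_sqrt_unique[OF K(1) R(1)])
    show "K (K x) = R (R x)" for x
      by (simp add: K R)
    have "K (P x) = P (K x)" for x
      by (metis K(2))
    then show "K (R x) = R (K x)" for x
      by (rule comm[OF psd_bops[OF K(1)]])
  qed
  have eq: "op_sqrt whole P = R"
    unfolding op_sqrt_def
  proof (rule the_equality)
    show "psd whole R \<and> (\<forall>x\<in>carr whole. R (R x) = P x)"
      using R by blast
    show "K = R" if "psd whole K \<and> (\<forall>x\<in>carr whole. K (K x) = P x)" for K
      by (rule uniq) (use that in \<open>simp_all only: whole_simps UNIV_I ball_UNIV\<close>)
  qed
  show "psd whole (op_sqrt whole P)" "op_sqrt whole P (op_sqrt whole P x) = P x"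
    by (simp_all add: eq R)
  show "psd whole R' \<Longrightarrow> (\<And>x. R' (R' x) = P x) \<Longrightarrow> op_sqrt whole P = R'"
    using eq uniq by blast
qed

section \<open>Douglas' lemma and the polar decomposition\<close>

lemma orth_complD:
  "x \<in> orth_compl K \<Longrightarrow> y \<in> K \<Longrightarrow> cinner x y = 0"
  "x \<in> orth_compl K \<Longrightarrow> y \<in> K \<Longrightarrow> cinner y x = 0"
  by (simp add: orth_compl_def)
    (metis (mono_tags, lifting) cinner_commute complex_cnj_zero mem_Collect_eq orth_compl_def)

lemma orth_compl_zero: "0 \<in> orth_compl K"
  and orth_compl_add: "x \<in> orth_compl K \<Longrightarrow> y \<in> orth_compl K \<Longrightarrow> x + y \<in> orth_compl K"
  and orth_compl_diff: "x \<in> orth_compl K \<Longrightarrow> y \<in> orth_compl K \<Longrightarrow> x - y \<in> orth_compl K"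
  and orth_compl_scaleC: "x \<in> orth_compl K \<Longrightarrow> c *\<^sub>C x \<in> orth_compl K"
  by (simp_all add: orth_compl_def cinner_add_left cinner_diff_left cinner_scaleC_left)

lemma orth_compl_disjoint: "x \<in> K \<Longrightarrow> x \<in> orth_compl K \<Longrightarrow> x = 0"
  using orth_complD[of x K x] by (simp add: cinner_self)

lemma psd_range_orth_ker:
  assumes R: "psd whole R"
  shows "range R \<subseteq> orth_compl (hker R)"
  by (auto simp: orth_compl_def hker_def psd_sym[OF R])

lemma closure_range_orth_ker:
  assumes R: "psd whole R"
  shows "closure (range R) \<subseteq> orth_compl (hker R)"
proof
  fix z assume "z \<in> closure (range R)"
  then obtain f where f: "\<And>n. f n \<in> range R" "f \<longlonglongrightarrow> z"
    by (auto simp: closure_sequential)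
  have "cinner z k = 0" if k: "k \<in> hker R" for k
  proof (rule LIMSEQ_unique)
    show "(\<lambda>n. cinner (f n) k) \<longlonglongrightarrow> cinner z k"
      by (rule tendsto_cinner[OF f(2) tendsto_const])
    have "cinner (f n) k = 0" for n
      using f(1)[of n] k orth_complD psd_range_orth_ker[OF R] by blast
    then show "(\<lambda>n. cinner (f n) k) \<longlonglongrightarrow> 0"
      by simp
  qed
  then show "z \<in> orth_compl (hker R)"
    by (simp add: orth_compl_def)
qed

lemma psd_inj_on:
  assumes R: "psd whole R" and "z \<in> orth_compl (hker R)" "w \<in> orth_compl (hker R)" "R z = R w"
  shows "z = w"
proof -
  have "z - w \<in> hker R"
    using assms(4) by (simp add: hker_def bops_diff[OF psd_bops[OF R]])
  then show ?thesis
    using orth_compl_disjoint[OF _ orth_compl_diff[OF assms(2,3)]] by simp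
qed

text \<open>
  The operator inequality \<open>x x\<^sup>* \<le> C\<^sup>2 R\<^sup>2\<close> is the bound on \<open>\<langle>y, x\<rangle>\<close>. Representing this
  functional as \<open>\<langle>R y, z\<rangle> = \<langle>y, R z\<rangle>\<close> gives \<open>R z = x\<close>.
\<close>

lemma Douglas_vector:
  fixes R :: "'a::chilbert_space \<Rightarrow> 'a"
  assumes R: "psd whole R" and C: "0 \<le> C" and bound: "\<And>y. cmod (cinner y x) \<le> C * norm (R y)"
  shows "\<exists>z\<in>closure (range R). norm z \<le> C \<and> R z = x"
proof -
  obtain z where z: "z \<in> closure (range R)" "norm z \<le> C" "\<And>y. cinner y x = cinner (R y) z"
    using riesz_range[OF psd_bops[OF R] bops_ident C bound] by blast
  have "R z = x"
    by (rule cinner_ext) (simp add: z(3) psd_sym[OF R])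
  with z show ?thesis by blast
qed

text \<open>
  Here \<open>v - z\<close> lies in \<open>Ker R\<close> and \<open>z\<close> is orthogonal to it, so \<open>z\<close> is the projection of \<open>v\<close> onto
  \<open>(Ker R)\<^sup>\<bottom>\<close>.
\<close>

lemma ex_same_image_in_closure_range:
  fixes R :: "'a::chilbert_space \<Rightarrow> 'a"
  assumes R: "psd whole R"
  shows "\<exists>z\<in>closure (range R). R z = R v"
proof -
  have "cmod (cinner y (R v)) \<le> norm v * norm (R y)" for y
    using cinner_Cauchy_Schwarz[of "R y" v] by (simp add: psd_sym[OF R] mult.commute)
  then show ?thesis
    using Douglas_vector[OF R, of "norm v" "R v"] by auto
qed

text \<open>
  A vector orthogonal to \<open>Ker R\<close> equals its projection, which lies in the closed range of \<open>R\<close>.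
\<close>

lemma orth_ker_eq_closure_range:
  fixes R :: "'a::chilbert_space \<Rightarrow> 'a"
  assumes R: "psd whole R"
  shows "orth_compl (hker R) = closure (range R)"
proof (rule antisym)
  show "orth_compl (hker R) \<subseteq> closure (range R)"
  proof
    fix v assume v: "v \<in> orth_compl (hker R)"
    obtain z where "z \<in> closure (range R)" "R z = R v"
      using ex_same_image_in_closure_range[OF R] by blast
    then show "v \<in> closure (range R)"
      using psd_inj_on[OF R _ v] closure_range_orth_ker[OF R] by blast
  qed
qed (rule closure_range_orth_ker[OF R])

text \<open>
  Instead of extending \<open>S y \<mapsto> W y\<close> to the closed range of \<open>S\<close>, the adjoint \<open>V'\<close> is constructed:
  Douglas' lemma solves \<open>S z = W\<^sup>* l\<close> with \<open>z \<bottom> Ker S\<close> for each \<open>l\<close>, and uniqueness of \<open>z\<close> makes it linear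
  in \<open>l\<close>.
\<close>

lemma polar_decomposition:
  fixes S :: "'x::chilbert_space \<Rightarrow> 'x" and W :: "'x \<Rightarrow> 'h::chilbert_space"
  assumes S: "psd whole S" and W: "W \<in> bops whole whole" and norm: "\<And>y. norm (W y) = norm (S y)"
  obtains V V' where "V \<in> bops whole whole" "V' \<in> bops whole whole"
    "\<And>m l. cinner (V m) l = cinner m (V' l)"
    "\<And>y. V (S y) = W y" "\<And>l. S (V' l) = adj whole whole W l"
    "\<And>l. V' l \<in> orth_compl (hker S)" "\<And>m. m \<in> orth_compl (hker S) \<Longrightarrow> V' (V m) = m"
proof -
  define W' where "W' = adj whole whole W"
  have W': "W' \<in> bops whole whole" "\<And>y l. cinner (W y) l = cinner y (W' l)"
    using bops_adj[OF W] cinner_adj[OF W] by (auto simp: W'_def)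
  note Sb = psd_bops[OF S]
  have "\<exists>z. z \<in> orth_compl (hker S) \<and> norm z \<le> norm l \<and> S z = W' l" for l
  proof -
    have "cmod (cinner y (W' l)) \<le> norm l * norm (S y)" for y
      using cinner_Cauchy_Schwarz[of "W y" l] by (simp add: W' norm mult.commute)
    then show ?thesis
      using Douglas_vector[OF S, of "norm l" "W' l"] orth_ker_eq_closure_range[OF S] by auto
  qed
  then obtain V' where V': "\<And>l. V' l \<in> orth_compl (hker S)" "\<And>l. norm (V' l) \<le> norm l"
    "\<And>l. S (V' l) = W' l"
    by metis
  have V'b: "V' \<in> bops whole whole"
  proof (rule bops_wholeI[of _ 1])
    show "V' (k + l) = V' k + V' l" for k l
      by (rule psd_inj_on[OF S]) (simp_all add: V' orth_compl_add bops_add[OF Sb] bops_add[OF W'(1)])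
    show "V' (c *\<^sub>C l) = c *\<^sub>C V' l" for c l
      by (rule psd_inj_on[OF S]) (simp_all add: V' orth_compl_scaleC bops_scaleC[OF Sb] bops_scaleC[OF W'(1)])
  qed (simp add: V'(2))
  define V where "V = adj whole whole V'"
  have VV': "cinner (V m) l = cinner m (V' l)" for m l
    using cinner_adj[OF V'b, of l m] by (metis V_def cinner_commute)
  have VS: "V (S y) = W y" for y
  proof (rule cinner_ext)
    show "cinner l (V (S y)) = cinner l (W y)" for l
      using VV'[of "S y" l] W'(2)[of y l] by (metis V'(3) cinner_commute psd_sym[OF S])
  qed
  have Vb: "V \<in> bops whole whole"
    unfolding V_def by (rule bops_adj[OF V'b])
  (* Both sides are orthogonal to Ker S, and S V' W y = W* W y = S S y. *)
  have V'W: "V' (W y) = S y" for y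
  proof (rule psd_inj_on[OF S V'(1)])
    show "S y \<in> orth_compl (hker S)"
      using psd_range_orth_ker[OF S] by blast
    show "S (V' (W y)) = S (S y)"
    proof (rule cinner_ext)
      fix u
      have "inner (W a) (W b) = inner (S a) (S b)" for a b
      proof -
        (* Polarisation of |W z| = |S z|. *)
        have sq: "inner (W z) (W z) = inner (S z) (S z)" for z
          by (simp add: norm flip: power2_norm_eq_inner)
        show ?thesis
          using sq[of "a + b"] sq[of a] sq[of b]
          by (simp add: bops_add[OF W] bops_add[OF Sb] inner_simps inner_commute)
      qed
      then have "Re (cinner (S a) (S b)) = Re (cinner (W a) (W b))" for a b
        by (simp add: inner_eq_Re_cinner)
      then have "cinner (S u) (S y) = cinner (W u) (W y)"
        by (intro cinner_eqI_Re) (simp_all add: bops_scaleC[OF W] bops_scaleC[OF Sb])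
      then show "cinner u (S (V' (W y))) = cinner u (S (S y))"
        by (simp add: V'(3) W'(2) psd_sym[OF S])
    qed
  qed
  (* By the previous step this holds on the range of S; pairing with S y carries it to all of (Ker S)^perp. *)
  have "V' (V m) = m" if m: "m \<in> orth_compl (hker S)" for m
  proof (rule psd_inj_on[OF S V'(1) m], rule cinner_ext)
    show "cinner y (S (V' (V m))) = cinner y (S m)" for y
      by (metis V'W VS VV' cinner_commute psd_sym[OF S])
  qed
  then show thesis
    using that[of V V'] Vb V'b VV' VS V' by (simp add: W'_def)
qed

section \<open>Operator ranges and de Branges--Rovnyak spaces\<close>

text \<open>
  The range of \<open>Q\<close> with the inner product that makes \<open>Q\<close> unitary from \<open>(Ker Q)\<^sup>\<bottom>\<close> onto it, and the inverse
  \<open>lift\<close> of that unitary. On the ambient space \<open>lift \<circ> Q\<close> is the orthogonal projection onto \<open>(Ker Q)\<^sup>\<bottom>\<close>.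
\<close>

locale operator_range =
  fixes Q :: "'h::chilbert_space \<Rightarrow> 'h" and H :: "'h ipspace" and lift :: "'h \<Rightarrow> 'h"
  assumes Q: "psd whole Q"
    and carr_H: "carr H = range Q"
    and ip_H: "\<And>g g'. g \<in> range Q \<Longrightarrow> g' \<in> range Q \<Longrightarrow> ip H g g' = cinner (lift g) (lift g')"
    and lift_orth: "\<And>g. g \<in> range Q \<Longrightarrow> lift g \<in> orth_compl (hker Q)"
    and Q_lift: "\<And>g. g \<in> range Q \<Longrightarrow> Q (lift g) = g"
begin

lemmas Qb = psd_bops[OF Q]
lemmas Q_sym = psd_sym[OF Q]

lemma lift_Q_cancel: "l \<in> orth_compl (hker Q) \<Longrightarrow> lift (Q l) = l"
  using psd_inj_on[OF Q lift_orth] Q_lift by blast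

lemma lift_Q_orth [simp]: "lift (Q v) \<in> orth_compl (hker Q)"
  by (simp add: lift_orth)

lemma Q_lift_Q [simp]: "Q (lift (Q v)) = Q v"
  by (simp add: Q_lift)

lemma lift_Q_ker: "v - lift (Q v) \<in> hker Q"
  by (simp add: hker_def bops_diff[OF Qb])

lemma cinner_lift_Q:
  assumes "l \<in> orth_compl (hker Q)"
  shows "cinner l (lift (Q v)) = cinner l v" "cinner (lift (Q v)) l = cinner v l"
  using orth_complD[OF assms lift_Q_ker, of v] by (simp_all add: cinner_diff_left cinner_diff_right)

lemma norm_lift_Q_le: "norm (lift (Q v)) \<le> norm v"
proof -
  have "(norm (lift (Q v)))\<^sup>2 = inner (lift (Q v)) v"
    using cinner_lift_Q(1)[of "lift (Q v)" v] by (simp add: power2_norm_eq_inner inner_eq_Re_cinner)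
  also have "\<dots> \<le> norm (lift (Q v)) * norm v"
    by (rule norm_cauchy_schwarz)
  finally show ?thesis
    by (cases "lift (Q v) = 0") (simp_all add: power2_eq_square)
qed

lemma lift_Q_bops: "(\<lambda>v. lift (Q v)) \<in> bops whole whole"
proof (rule bops_wholeI[of _ 1])
  show "lift (Q (v + w)) = lift (Q v) + lift (Q w)" for v w
    by (rule psd_inj_on[OF Q lift_Q_orth orth_compl_add[OF lift_Q_orth lift_Q_orth]],
        simp only: Q_lift_Q, simp only: bops_add[OF Qb] Q_lift_Q)
  show "lift (Q (c *\<^sub>C v)) = c *\<^sub>C lift (Q v)" for c v
    by (rule psd_inj_on[OF Q lift_Q_orth orth_compl_scaleC[OF lift_Q_orth]],
        simp only: Q_lift_Q, simp only: bops_scaleC[OF Qb] Q_lift_Q)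
qed (simp add: norm_lift_Q_le)

lemma range_add: "g \<in> range Q \<Longrightarrow> g' \<in> range Q \<Longrightarrow> g + g' \<in> range Q"
  and range_diff: "g \<in> range Q \<Longrightarrow> g' \<in> range Q \<Longrightarrow> g - g' \<in> range Q"
  and range_scaleC: "g \<in> range Q \<Longrightarrow> c *\<^sub>C g \<in> range Q"
  by (auto simp flip: bops_add[OF Qb] bops_diff[OF Qb] bops_scaleC[OF Qb])

lemma lift_add: "g \<in> range Q \<Longrightarrow> g' \<in> range Q \<Longrightarrow> lift (g + g') = lift g + lift g'"
  using bops_add[OF lift_Q_bops] by (auto simp: bops_add[OF Qb])

lemma lift_diff: "g \<in> range Q \<Longrightarrow> g' \<in> range Q \<Longrightarrow> lift (g - g') = lift g - lift g'"
  using bops_diff[OF lift_Q_bops] by (auto simp: bops_diff[OF Qb])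

lemma lift_scaleC: "g \<in> range Q \<Longrightarrow> lift (c *\<^sub>C g) = c *\<^sub>C lift g"
  using bops_scaleC[OF lift_Q_bops] by (auto simp: bops_scaleC[OF Qb])

lemma lift_eq_iff: "g \<in> range Q \<Longrightarrow> g' \<in> range Q \<Longrightarrow> lift g = lift g' \<longleftrightarrow> g = g'"
  by (metis Q_lift)

lemma hnorm_H: "g \<in> range Q \<Longrightarrow> hnorm H g = norm (lift g)"
  by (simp add: hnorm_def ip_H cinner_self)

text \<open>
  A projection is its own positive square root. Uniqueness is inherited from the ambient space: if \<open>R\<close>
  is a positive square root on the operator range, then \<open>lift \<circ> R \<circ> Q\<close> is one of \<open>P\<close>.
\<close>

lemma op_sqrt_projection:
  assumes P: "psd whole P" and idem: "\<And>v. P (P v) = P v" and orth: "\<And>v. P v \<in> orth_compl (hker Q)"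
  shows "op_sqrt H (\<lambda>h\<in>carr H. Q (P (lift h))) = (\<lambda>h\<in>carr H. Q (P (lift h)))"
proof -
  define E where "E = (\<lambda>h\<in>carr H. Q (P (lift h)))"
  note Pb = psd_bops[OF P]
  have E: "E h = Q (P (lift h))" if "h \<in> range Q" for h
    using that by (simp add: E_def carr_H)
  have lift_E: "lift (E h) = P (lift h)" if "h \<in> range Q" for h
    using that by (simp add: E lift_Q_cancel orth)
  obtain b where b: "\<And>v. norm (P v) \<le> b * norm v"
    using bops_pos_bound[OF Pb] by blast
  have "E \<in> bops H H"
    unfolding bops_def
  proof (intro CollectI conjI ballI allI exI[of _ b])
    show "E \<in> carr H \<rightarrow>\<^sub>E carr H"
      by (auto simp: E_def carr_H)
    fix g h c assume g: "g \<in> carr H"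
    show "E (c *\<^sub>C g) = c *\<^sub>C E g"
      using g by (simp add: carr_H E range_scaleC lift_scaleC bops_scaleC[OF Pb] bops_scaleC[OF Qb])
    show "hnorm H (E g) \<le> b * hnorm H g"
      using g b by (simp add: carr_H E[symmetric] hnorm_H lift_E) (simp add: E hnorm_H lift_Q_cancel orth)
    assume h: "h \<in> carr H"
    show "E (g + h) = E g + E h"
      using g h by (simp add: carr_H E range_add lift_add bops_add[OF Pb] bops_add[OF Qb])
  qed
  moreover have "ip H (E h) h = cinner (P (lift h)) (lift h)" if "h \<in> carr H" for h
    using that lift_E[of h] by (simp add: carr_H ip_H E)
  ultimately have "psd H E"
    using P by (simp add: psd_def)
  moreover have "E (E h) = E h" if "h \<in> carr H" for h
    using that by (simp add: carr_H E lift_Q_cancel orth idem)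
  moreover have "R = E" if R: "psd H R" and RR: "\<forall>h\<in>carr H. R (R h) = E h" for R
  proof -
    have Rb: "R \<in> bops H H"
      using R by (simp add: psd_def)
    then have R_in: "R h \<in> range Q" if "h \<in> range Q" for h
      using that by (auto simp: bops_def carr_H)
    obtain c where c: "\<And>h. h \<in> range Q \<Longrightarrow> hnorm H (R h) \<le> c * hnorm H h"
    proof -
      have "\<exists>c. \<forall>h\<in>range Q. hnorm H (R h) \<le> c * hnorm H h"
        using Rb unfolding bops_def carr_H by blast
      then show thesis using that by blast
    qed
    define R' where "R' v = lift (R (Q v))" for v
    have "R' \<in> bops whole whole"
    proof (rule bops_wholeI[of _ "\<bar>c\<bar>"])
      show "R' (v + w) = R' v + R' w" for v w
        using Rb R_in by (simp add: R'_def bops_add[OF Qb] bops_def carr_H lift_add)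
      show "R' (a *\<^sub>C v) = a *\<^sub>C R' v" for a v
        using Rb R_in by (simp add: R'_def bops_scaleC[OF Qb] bops_def carr_H lift_scaleC)
      show "norm (R' v) \<le> \<bar>c\<bar> * norm v" for v
      proof -
        have "norm (R' v) \<le> c * norm (lift (Q v))"
          using c[of "Q v"] R_in by (simp add: R'_def hnorm_H)
        also have "\<dots> \<le> \<bar>c\<bar> * norm v"
          by (intro mult_mono norm_lift_Q_le) auto
        finally show ?thesis .
      qed
    qed
    moreover have "cinner (R' v) v = ip H (R (Q v)) (Q v)" for v
      using R_in by (simp add: R'_def ip_H cinner_lift_Q lift_orth)
    ultimately have "psd whole R'"
      using R by (simp add: psd_def carr_H)
    moreover have "R' (R' v) = P v" for v
    proof -
      have "R' (R' v) = P (lift (Q v))"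
        using RR R_in lift_E by (simp add: R'_def Q_lift carr_H)
      also have "\<dots> = P v"
        by (rule cinner_ext) (simp add: psd_sym[OF P, symmetric] cinner_lift_Q orth)
      finally show ?thesis .
    qed
    ultimately have "op_sqrt whole P = R'"
      by (rule op_sqrt_wholeI[OF P])
    moreover have "op_sqrt whole P = P"
      by (rule op_sqrt_wholeI[OF P P idem])
    ultimately have R'P: "R' v = P v" for v
      by simp
    show ?thesis
    proof
      fix h
      show "R h = E h"
      proof (cases "h \<in> carr H")
        case True
        then show ?thesis
          using R'P[of "lift h"] R_in Q_lift by (metis E R'_def carr_H)
      next
        case False
        then show ?thesis
          using Rb by (auto simp: bops_def E_def PiE_def extensional_def)
      qed
    qed
  qed
  ultimately show ?thesis
    unfolding op_sqrt_def E_def[symmetric] by (intro the_equality) blast+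
qed

end

text \<open>
  The range of \<open>S\<close> is dense in \<open>(Ker S)\<^sup>\<bottom>\<close>; hence the isometric factor of the polar decomposition is
  unique.
\<close>

lemma (in operator_range) bops_eq_of_eq_on_range:
  fixes S :: "'x::chilbert_space \<Rightarrow> 'x"
  assumes S: "psd whole S" and V: "V \<in> bops whole whole" and orth: "\<And>m. V m \<in> orth_compl (hker Q)"
    and F: "F \<in> bops (sub_space (orth_compl (hker S))) H"
    and eq: "\<And>y. F (S y) = Q (V (S y))" and m: "m \<in> orth_compl (hker S)"
  shows "F m = Q (V m)"
proof -
  have SM: "S y \<in> orth_compl (hker S)" for y
    using psd_range_orth_ker[OF S] by blast
  have F_in: "F z \<in> range Q" if "z \<in> orth_compl (hker S)" for z
    using F that by (auto simp: bops_def carr_H)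
  have F_diff: "F (z - w) = F z - F w"
    if "z \<in> orth_compl (hker S)" "w \<in> orth_compl (hker S)" for z w
  proof -
    have "F ((z - w) + w) = F (z - w) + F w"
      using F that orth_compl_diff[OF that] unfolding bops_def sub_space_simps by blast
    then show ?thesis by simp
  qed
  have "\<exists>b. \<forall>z\<in>orth_compl (hker S). hnorm H (F z) \<le> b * norm z"
    using F by (simp add: bops_def)
  then obtain b where b: "\<And>z. z \<in> orth_compl (hker S) \<Longrightarrow> hnorm H (F z) \<le> b * norm z"
    by blast
  obtain f where f: "\<And>n. f n \<in> range S" "f \<longlonglongrightarrow> m"
    using m unfolding orth_ker_eq_closure_range[OF S] closure_sequential by blast
  have fM: "f n \<in> orth_compl (hker S)" for n
    using f(1)[of n] SM by auto
  have "lift (F m) = V m"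
  proof (rule LIMSEQ_unique)
    show "(\<lambda>n. V (f n)) \<longlonglongrightarrow> V m"
      by (rule bounded_linear.tendsto[OF bops_bounded_linear[OF V] f(2)])
    have le: "norm (V (f n) - lift (F m)) \<le> norm (m - f n) * b" for n
    proof -
      have "F (f n) = Q (V (f n))"
        using f(1)[of n] eq by auto
      then have "lift (F (m - f n)) = lift (F m) - V (f n)"
        using m fM[of n] F_in by (simp add: F_diff lift_diff lift_Q_cancel orth)
      then show ?thesis
        using b[of "m - f n"] m fM[of n] F_in[of "m - f n"]
        by (simp add: hnorm_H orth_compl_diff norm_minus_commute mult.commute)
    qed
    have "(\<lambda>n. m - f n) \<longlonglongrightarrow> 0"
      using tendsto_diff[OF tendsto_const f(2), of m] by simp
    then have "(\<lambda>n. V (f n) - lift (F m)) \<longlonglongrightarrow> 0"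
      by (rule tendsto_0_le[OF _ always_eventually[OF allI[OF le]]])
    then show "(\<lambda>n. V (f n)) \<longlonglongrightarrow> lift (F m)"
      by (rule LIM_zero_cancel)
  qed
  then show ?thesis
    using Q_lift[OF F_in[OF m]] by simp
qed

text \<open>
  A contraction has a contractive adjoint, so \<open>\<langle>(I - T T\<^sup>*) y, y\<rangle> = \<parallel>y\<parallel>\<^sup>2 - \<parallel>T\<^sup>* y\<parallel>\<^sup>2\<close> is nonnegative.
\<close>

lemma psd_defect:
  fixes T :: "'k::chilbert_space \<Rightarrow> 'h::chilbert_space"
  assumes T: "contraction whole whole T"
  shows "psd whole (\<lambda>y. y - T (adj whole whole T y))"
proof -
  have Tb: "T \<in> bops whole whole" and le: "\<And>u. norm (T u) \<le> norm u"
    using T by (auto simp: contraction_def hnorm_whole)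
  let ?T' = "adj whole whole T"
  have sym: "cinner (T (?T' y)) z = cinner (?T' y) (?T' z)" for y z
    by (rule cinner_adj[OF Tb])
  have le': "norm (?T' y) \<le> norm y" for y
  proof -
    have "(norm (?T' y))\<^sup>2 = Re (cinner (T (?T' y)) y)"
      by (simp add: sym cinner_self)
    also have "\<dots> \<le> norm (T (?T' y)) * norm y"
      using complex_Re_le_cmod cinner_Cauchy_Schwarz order_trans by blast
    also have "\<dots> \<le> norm (?T' y) * norm y"
      by (intro mult_right_mono le) simp
    finally show ?thesis
      by (cases "?T' y = 0") (simp_all add: power2_eq_square)
  qed
  show ?thesis
  proof (rule psd_wholeI)
    show "(\<lambda>y. y - T (?T' y)) \<in> bops whole whole"
      by (rule bops_minus[OF bops_ident bops_comp[OF Tb bops_adj[OF Tb]]])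
    have "cinner y (T (?T' z)) = cinner (?T' y) (?T' z)" for y z
      by (metis cinner_commute sym)
    then show "cinner (y - T (?T' y)) z = cinner y (z - T (?T' z))" for y z
      by (simp add: cinner_diff_left cinner_diff_right sym)
    show "0 \<le> Re (cinner (y - T (?T' y)) y)" for y
      using power_mono[OF le'[of y], of 2] by (simp add: cinner_diff_left sym cinner_self)
  qed
qed

lemma orth_proj_hker:
  fixes Q :: "'h::chilbert_space \<Rightarrow> 'h"
  assumes Q: "psd whole Q"
  shows "orth_proj (hker Q) v \<in> hker Q" "v - orth_proj (hker Q) v \<in> orth_compl (hker Q)"
proof -
  note Qb = psd_bops[OF Q]
  obtain z where z: "z \<in> orth_compl (hker Q)" "Q z = Q v"
    using ex_same_image_in_closure_range[OF Q] orth_ker_eq_closure_range[OF Q] by blast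
  have "\<exists>!p. p \<in> hker Q \<and> v - p \<in> orth_compl (hker Q)"
  proof (rule ex1I[of _ "v - z"])
    show "v - z \<in> hker Q \<and> v - (v - z) \<in> orth_compl (hker Q)"
      using z by (simp add: hker_def bops_diff[OF Qb])
    fix p assume p: "p \<in> hker Q \<and> v - p \<in> orth_compl (hker Q)"
    have "v - p = z"
      by (rule psd_inj_on[OF Q]) (use p z in \<open>simp_all add: hker_def bops_diff[OF Qb]\<close>)
    then show "p = v - z" by auto
  qed
  from theI'[OF this] show "orth_proj (hker Q) v \<in> hker Q" "v - orth_proj (hker Q) v \<in> orth_compl (hker Q)"
    unfolding orth_proj_def by auto
qed

text \<open>
  The projection \<open>\<pi>\<close> onto \<open>Ker Q\<close> satisfies \<open>y - \<pi> y = lift (Q y)\<close>. This vector depends on \<open>Q y\<close> alone, so the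
  description of the inner product determines a unique number.
\<close>

lemma dBR_operator_range:
  fixes T :: "'k::chilbert_space \<Rightarrow> 'h::chilbert_space"
  assumes T: "contraction whole whole T"
  obtains lift where "operator_range (defect_sqrt T) (dBR T) lift"
    "\<And>y. defect_sqrt T (defect_sqrt T y) = y - T (adj whole whole T y)"
proof -
  define Q where "Q = defect_sqrt T"
  have Q: "psd whole Q" and QQ: "\<And>y. Q (Q y) = y - T (adj whole whole T y)"
    unfolding Q_def defect_sqrt_def by (rule op_sqrt_whole[OF psd_defect[OF T]])+
  note Qb = psd_bops[OF Q]
  define lift where "lift g = (SOME l. l \<in> orth_compl (hker Q) \<and> Q l = g)" for g
  have lift: "lift g \<in> orth_compl (hker Q) \<and> Q (lift g) = g" if g: "g \<in> range Q" for g
    unfolding lift_def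
  proof (rule someI_ex)
    obtain v where "g = Q v" using g by blast
    then show "\<exists>l. l \<in> orth_compl (hker Q) \<and> Q l = g"
      using ex_same_image_in_closure_range[OF Q, of v] orth_ker_eq_closure_range[OF Q] by blast
  qed
  define \<pi> where "\<pi> = orth_proj (hker Q)"
  have \<pi>: "y - \<pi> y = lift (Q y)" for y
    by (rule psd_inj_on[OF Q])
      (use orth_proj_hker[OF Q, of y] lift[of "Q y"] in \<open>simp_all add: \<pi>_def hker_def bops_diff[OF Qb]\<close>)
  have dBR: "carr (dBR T) = range Q"
    "ip (dBR T) u v = (THE c. \<exists>y z. u = Q y \<and> v = Q z \<and> c = cinner (y - \<pi> y) (z - \<pi> z))" for u v
    by (simp_all add: dBR_def Let_def Q_def \<pi>_def)
  have "operator_range Q (dBR T) lift"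
  proof
    fix g g' assume g: "g \<in> range Q" "g' \<in> range Q"
    show "ip (dBR T) g g' = cinner (lift g) (lift g')"
      unfolding dBR(2) \<pi> by (rule the_equality) (use g in auto)
  qed (use Q dBR lift in auto)
  then show thesis
    using that QQ by (simp add: Q_def)
qed

section \<open>Fibres of the adjoint of an isometry into an operator range\<close>

text \<open>
  The isometry \<open>Ft\<close> acts between spaces with inner products of their own. Through \<open>Ft = Q V\<close> its properties
  are those of a partial isometry \<open>V\<close> of the ambient spaces with adjoint \<open>V'\<close>, and \<open>Ft\<^sup>[\<^sup>*\<^sup>] = V' lift\<close>.
\<close>

locale isometric_factor = operator_range Q H lift
  for Q :: "'h::chilbert_space \<Rightarrow> 'h" and H lift +
  fixes K :: "'x::chilbert_space set" and V :: "'x \<Rightarrow> 'h" and V' :: "'h \<Rightarrow> 'x" and Ft :: "'x \<Rightarrow> 'h"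
  assumes V: "V \<in> bops whole whole" and V': "V' \<in> bops whole whole"
    and VV': "\<And>m l. cinner (V m) l = cinner m (V' l)"
    and V'_in: "\<And>l. V' l \<in> orth_compl K"
    and V'_V: "\<And>m. m \<in> orth_compl K \<Longrightarrow> V' (V m) = m"
    and V_orth: "\<And>m. V m \<in> orth_compl (hker Q)"
    and Ft: "\<And>m. m \<in> orth_compl K \<Longrightarrow> Ft m = Q (V m)"
    and Ft_bops: "Ft \<in> bops (sub_space (orth_compl K)) H"
begin

text \<open>
  The orthogonal projection onto the orthogonal complement of \<open>Ran V\<close> in \<open>(Ker Q)\<^sup>\<bottom>\<close>: the projection
  \<open>I - Ft Ft\<^sup>[\<^sup>*\<^sup>]\<close> carried back by \<open>lift\<close>.
\<close>

definition defect_proj :: "'h \<Rightarrow> 'h"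
  where "defect_proj v = lift (Q v) - V (V' v)"

text \<open>The kernel of \<open>Ft\<^sup>[\<^sup>*\<^sup>]\<close>.\<close>

definition defect_space :: "'h set"
  where "defect_space = {h \<in> range Q. V' (lift h) = 0}"

lemma lift_QV [simp]: "lift (Q (V m)) = V m"
  by (rule lift_Q_cancel[OF V_orth])

lemma lift_Ft: "m \<in> orth_compl K \<Longrightarrow> lift (Ft m) = V m"
  by (simp add: Ft)

lemma Ft_in_range: "m \<in> orth_compl K \<Longrightarrow> Ft m \<in> range Q"
  by (simp add: Ft)

lemma V'_lift_Q: "V' (lift (Q v)) = V' v"
  by (rule cinner_ext) (simp add: VV'[symmetric] cinner_lift_Q V_orth)

lemma norm_V: "m \<in> orth_compl K \<Longrightarrow> norm (V m) = norm m"
  using VV'[of m "V m"] by (simp add: V'_V norm_eq_sqrt_inner inner_eq_Re_cinner)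

lemma hnorm_Ft: "m \<in> orth_compl K \<Longrightarrow> hnorm H (Ft m) = norm m"
  by (simp add: hnorm_H Ft_in_range lift_Ft norm_V)

lemma isometry_Ft: "isometry (sub_space (orth_compl K)) H Ft"
  by (simp add: isometry_def Ft_bops hnorm_Ft)

lemma adj_Ft:
  assumes h: "h \<in> range Q"
  shows "adj (sub_space (orth_compl K)) H Ft h = V' (lift h)"
proof (rule adj_eqI)
  show "ip H (Ft m) h = ip (sub_space (orth_compl K)) m (V' (lift h))"
    if "m \<in> carr (sub_space (orth_compl K))" for m
    using that h by (simp add: ip_H Ft_in_range lift_Ft VV')
  show "z = V' (lift h)" if z: "z \<in> carr (sub_space (orth_compl K))"
    "\<forall>m\<in>carr (sub_space (orth_compl K)). ip (sub_space (orth_compl K)) m z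
      = ip (sub_space (orth_compl K)) m (V' (lift h))" for z
  proof -
    have "z - V' (lift h) \<in> orth_compl K"
      using z(1) V'_in by (simp add: orth_compl_diff)
    then have "cinner (z - V' (lift h)) z = cinner (z - V' (lift h)) (V' (lift h))"
      using z(2) by simp
    then have "cinner (z - V' (lift h)) (z - V' (lift h)) = 0"
      unfolding cinner_diff_right[of "z - V' (lift h)"] by simp
    then show ?thesis
      by (simp add: cinner_self)
  qed
qed (use h V'_in in \<open>simp_all add: carr_H\<close>)

lemma defect_proj_orth: "defect_proj v \<in> orth_compl (hker Q)"
  by (simp add: defect_proj_def orth_compl_diff V_orth)

lemma V'_defect_proj: "V' (defect_proj v) = 0"
  by (simp add: defect_proj_def bops_diff[OF V'] V'_lift_Q V'_V V'_in)

lemma defect_proj_idem: "defect_proj (defect_proj v) = defect_proj v"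
  unfolding defect_proj_def[of "defect_proj v"] by (simp add: V'_defect_proj bops_zero[OF V] lift_Q_cancel defect_proj_orth)

lemma psd_defect_proj: "psd whole defect_proj"
proof (rule psd_wholeI)
  show "defect_proj \<in> bops whole whole"
    using bops_minus[OF lift_Q_bops bops_comp[OF V V']] by (simp add: defect_proj_def[abs_def])
  have *: "cinner (lift (Q v)) w = cinner v (lift (Q w))" for v w
    using cinner_lift_Q[OF lift_Q_orth] by metis
  have **: "cinner (V (V' v)) w = cinner v (V (V' w))" for v w
    by (metis VV' cinner_commute)
  show sym: "cinner (defect_proj v) w = cinner v (defect_proj w)" for v w
    by (simp add: defect_proj_def cinner_diff_left cinner_diff_right * **)
  show "0 \<le> Re (cinner (defect_proj v) v)" for v
  proof -
    have "cinner (defect_proj v) v = cinner (defect_proj v) (defect_proj v)"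
      by (metis sym defect_proj_idem)
    then show ?thesis
      by (simp add: cinner_self)
  qed
qed

lemma defect_eq:
  "(\<lambda>h\<in>carr H. h - Ft (adj (sub_space (orth_compl K)) H Ft h)) = (\<lambda>h\<in>carr H. Q (defect_proj (lift h)))"
  by (rule restrict_ext)
    (simp add: carr_H adj_Ft Ft V'_in defect_proj_def bops_diff[OF Qb] Q_lift)

lemma Q_defect_proj_in_space: "Q (defect_proj v) \<in> defect_space"
  by (simp add: defect_space_def lift_Q_cancel defect_proj_orth V'_defect_proj)

lemma defect_space_fixed: "h \<in> defect_space \<Longrightarrow> Q (defect_proj (lift h)) = h"
  by (auto simp: defect_space_def defect_proj_def bops_zero[OF V] Q_lift)

text \<open>
  By the previous lemmas \<open>I - Ft Ft\<^sup>[\<^sup>*\<^sup>]\<close> is a projection with range \<open>Ker Ft\<^sup>[\<^sup>*\<^sup>]\<close>. It is therefore its own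
  square root, and its range is closed as the kernel of a bounded operator.
\<close>

lemma closure_range_defect:
  "hclosure H (op_sqrt H (\<lambda>h\<in>carr H. h - Ft (adj (sub_space (orth_compl K)) H Ft h)) ` carr H) = defect_space"
proof -
  have img: "(\<lambda>h\<in>carr H. Q (defect_proj (lift h))) ` carr H = defect_space"
  proof (intro set_eqI iffI)
    show "h \<in> defect_space" if "h \<in> (\<lambda>h\<in>carr H. Q (defect_proj (lift h))) ` carr H" for h
      using that Q_defect_proj_in_space by auto
    show "h \<in> (\<lambda>h\<in>carr H. Q (defect_proj (lift h))) ` carr H" if h: "h \<in> defect_space" for h
    proof (rule image_eqI)
      show "h \<in> carr H"
        using h by (simp add: defect_space_def carr_H)
      then show "h = (\<lambda>h\<in>carr H. Q (defect_proj (lift h))) h"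
        by (simp add: defect_space_fixed[OF h])
    qed
  qed
  have "hclosure H defect_space = defect_space"
  proof (rule antisym)
    show "defect_space \<subseteq> hclosure H defect_space"
    proof
      fix h assume h: "h \<in> defect_space"
      then have "h \<in> carr H"
        by (simp add: defect_space_def carr_H)
      moreover have "hnorm H (h - h) < e" if "e > 0" for e
        using that hnorm_Ft[OF orth_compl_zero] by (simp add: Ft orth_compl_zero bops_zero[OF V] bops_zero[OF Qb])
      ultimately show "h \<in> hclosure H defect_space"
        using h unfolding hclosure_def by blast
    qed
    show "hclosure H defect_space \<subseteq> defect_space"
    proof
      fix h assume h: "h \<in> hclosure H defect_space"
      then have hQ: "h \<in> range Q"
        by (simp add: hclosure_def carr_H)
      obtain b where b: "b > 0" "\<And>v. norm (V' v) \<le> b * norm v"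
        using bops_pos_bound[OF V'] by blast
      have "norm (V' (lift h)) \<le> e" if e: "e > 0" for e
      proof -
        obtain s where s: "s \<in> defect_space" "hnorm H (h - s) < e / b"
          using h e b(1) by (auto simp: hclosure_def dest!: spec[of _ "e / b"])
        have "V' (lift h) = V' (lift h - lift s)"
          using s(1) by (simp add: bops_diff[OF V'] defect_space_def)
        moreover have "norm (lift h - lift s) < e / b"
          using s hQ by (simp add: defect_space_def hnorm_H range_diff lift_diff)
        ultimately show ?thesis
          using b(1) b(2)[of "lift h - lift s"] by (simp add: field_simps)
      qed
      then have "norm (V' (lift h)) \<le> 0"
        by (rule field_le_epsilon[of _ 0, simplified])
      then show "h \<in> defect_space"
        using hQ by (simp add: defect_space_def)
    qed
  qed
  then show ?thesis
    by (simp only: defect_eq op_sqrt_projection[OF psd_defect_proj defect_proj_idem defect_proj_orth] img)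
qed

text \<open>
  The fibre of \<open>Ft\<^sup>[\<^sup>*\<^sup>]\<close> over \<open>m\<close> is the translate of its kernel by \<open>Ft m\<close>, since \<open>Ft\<^sup>[\<^sup>*\<^sup>] Ft = I\<close>.
\<close>

lemma fibre_iff:
  assumes m: "m \<in> orth_compl K" and g: "g \<in> range Q"
  shows "V' (lift g) = m \<longleftrightarrow> g - Ft m \<in> defect_space"
  using assms by (simp add: defect_space_def range_diff Ft_in_range lift_diff lift_Ft bops_diff[OF V'] V'_V)

lemma norm_Pythagoras:
  assumes m: "m \<in> orth_compl K" and h: "h \<in> defect_space"
  shows "(hnorm H (Ft m + h))\<^sup>2 = (norm m)\<^sup>2 + (hnorm H h)\<^sup>2"
proof -
  have hQ: "h \<in> range Q" and V'h: "V' (lift h) = 0"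
    using h by (auto simp: defect_space_def)
  have "inner (V m) (lift h) = 0"
    by (simp add: inner_eq_Re_cinner VV' V'h)
  then have "(norm (V m + lift h))\<^sup>2 = (norm (V m))\<^sup>2 + (norm (lift h))\<^sup>2"
    by (simp add: power2_norm_eq_inner inner_simps inner_commute)
  then show ?thesis
    using m hQ by (simp add: hnorm_H range_add Ft_in_range lift_add lift_Ft norm_V)
qed

lemma norm_ball_iff:
  assumes m: "m \<in> orth_compl K" and h: "h \<in> defect_space"
  shows "hnorm H (Ft m + h) \<le> 1 \<longleftrightarrow> hnorm H h \<le> sqrt (1 - (norm m)\<^sup>2)"
proof -
  have nn: "0 \<le> hnorm H g" if "g \<in> range Q" for g
    using that by (simp add: hnorm_H)
  have hQ: "h \<in> range Q"
    using h by (simp add: defect_space_def)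
  have "hnorm H (Ft m + h) \<le> 1 \<longleftrightarrow> (hnorm H (Ft m + h))\<^sup>2 \<le> 1"
    using nn[of "Ft m + h"] hQ m by (simp add: abs_square_le_1 range_add Ft_in_range)
  also have "\<dots> \<longleftrightarrow> (hnorm H h)\<^sup>2 \<le> 1 - (norm m)\<^sup>2"
    unfolding norm_Pythagoras[OF m h] by (simp add: le_diff_eq add.commute)
  also have "\<dots> \<longleftrightarrow> hnorm H h \<le> sqrt (1 - (norm m)\<^sup>2)"
    using nn[OF hQ] real_le_rsqrt[of "hnorm H h"] 
    by (metis power_mono real_sqrt_ge_0_iff order_trans real_sqrt_pow2 real_le_rsqrt)
  finally show ?thesis .
qed

lemma solution_set:
  assumes m: "m \<in> orth_compl K"
  shows "{g \<in> range Q. V' (lift g) = m \<and> hnorm H g \<le> 1}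
    = {Ft m + h | h. h \<in> defect_space \<and> hnorm H h \<le> sqrt (1 - (norm m)\<^sup>2)}" (is "?L = ?R")
proof (intro set_eqI iffI)
  fix g assume "g \<in> ?L"
  then have "g - Ft m \<in> defect_space" "hnorm H (Ft m + (g - Ft m)) \<le> 1"
    using fibre_iff[OF m] by auto
  then show "g \<in> ?R"
    using norm_ball_iff[OF m, of "g - Ft m"] by (auto intro!: exI[of _ "g - Ft m"])
next
  fix g assume "g \<in> ?R"
  then obtain h where h: "g = Ft m + h" "h \<in> defect_space" "hnorm H h \<le> sqrt (1 - (norm m)\<^sup>2)"
    by blast
  have g: "g \<in> range Q"
    using h m by (simp add: defect_space_def range_add Ft_in_range)
  then show "g \<in> ?L"
    using h fibre_iff[OF m g] norm_ball_iff[OF m h(2)] by simp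
qed

text \<open>
  The ball of radius \<open>r = \<surd>(1 - \<parallel>m\<parallel>\<^sup>2)\<close> in \<open>Ker Ft\<^sup>[\<^sup>*\<^sup>]\<close> is \<open>{0}\<close> if and only if \<open>r = 0\<close> or the kernel is zero:
  any nonzero vector of the kernel can be scaled to norm \<open>r\<close>.
\<close>

lemma unique_solution_iff:
  assumes m: "m \<in> orth_compl K" and le: "norm m \<le> 1"
  shows "(\<exists>!g. g \<in> {Ft m + h | h. h \<in> defect_space \<and> hnorm H h \<le> sqrt (1 - (norm m)\<^sup>2)}) \<longleftrightarrow>
    norm m = 1 \<or> (\<forall>h\<in>carr H. Ft (adj (sub_space (orth_compl K)) H Ft h) = h)"
    (is "(\<exists>!g. g \<in> ?R) \<longleftrightarrow> ?A \<or> ?B")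
proof -
  define r where "r = sqrt (1 - (norm m)\<^sup>2)"
  have r: "0 \<le> r"
    using le by (simp add: r_def power_le_one)
  have zero_in: "0 \<in> defect_space"
    using Q_defect_proj_in_space[of 0] by (simp add: bops_zero[OF Qb] bops_zero[OF psd_bops[OF psd_defect_proj]])
  have lift0: "lift 0 = 0"
    using lift_Q_cancel[OF orth_compl_zero] by (simp add: bops_zero[OF Qb])
  have hnorm0: "hnorm H h = 0 \<longleftrightarrow> h = 0" if "h \<in> defect_space" for h
    using that lift_eq_iff[of h 0] zero_in by (simp add: defect_space_def hnorm_H lift0)
  have base: "Ft m \<in> ?R"
    using zero_in r hnorm0[OF zero_in] by (auto simp: r_def intro!: exI[of _ 0])
  have "(\<exists>!g. g \<in> ?R) \<longleftrightarrow> (\<forall>h\<in>defect_space. hnorm H h \<le> r \<longrightarrow> h = 0)"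
  proof
    assume "\<exists>!g. g \<in> ?R"
    then have "g = Ft m" if "g \<in> ?R" for g
      using base that by blast
    then have "Ft m + h = Ft m" if "h \<in> defect_space" "hnorm H h \<le> r" for h
      using that unfolding r_def by blast
    then show "\<forall>h\<in>defect_space. hnorm H h \<le> r \<longrightarrow> h = 0"
      by (metis add_cancel_left_right)
  next
    assume "\<forall>h\<in>defect_space. hnorm H h \<le> r \<longrightarrow> h = 0"
    then have "g = Ft m" if "g \<in> ?R" for g
      using that by (auto simp: r_def)
    with base show "\<exists>!g. g \<in> ?R"
      by (rule ex1I)
  qed
  also have "\<dots> \<longleftrightarrow> r = 0 \<or> (\<forall>h\<in>defect_space. h = 0)"
  proof
    assume *: "\<forall>h\<in>defect_space. hnorm H h \<le> r \<longrightarrow> h = 0"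
    show "r = 0 \<or> (\<forall>h\<in>defect_space. h = 0)"
    proof (rule ccontr)
      assume "\<not> (r = 0 \<or> (\<forall>h\<in>defect_space. h = 0))"
      then obtain h where h: "h \<in> defect_space" "h \<noteq> 0" and r0: "r > 0"
        using r by auto
      have hQ: "h \<in> range Q"
        using h by (simp add: defect_space_def)
      have n: "hnorm H h > 0"
        using hnorm0[OF h(1)] h(2) hQ by (simp add: hnorm_H)
      define k where "k = complex_of_real (r / hnorm H h) *\<^sub>C h"
      have kN: "k \<in> defect_space"
        using h by (simp add: k_def defect_space_def range_scaleC lift_scaleC bops_scaleC[OF V'])
      have "hnorm H k = r"
        using n r0 hQ by (simp add: k_def hnorm_H range_scaleC lift_scaleC norm_scaleC norm_divide)
      then show False
        using * kN hnorm0[OF kN] r0 by auto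
    qed
  next
    assume "r = 0 \<or> (\<forall>h\<in>defect_space. h = 0)"
    moreover have "hnorm H h \<ge> 0" if "h \<in> defect_space" for h
      using that by (simp add: defect_space_def hnorm_H)
    ultimately show "\<forall>h\<in>defect_space. hnorm H h \<le> r \<longrightarrow> h = 0"
      using hnorm0 by (metis order_antisym)
  qed
  also have "r = 0 \<longleftrightarrow> ?A"
  proof -
    have "r = 0 \<longleftrightarrow> (norm m)\<^sup>2 = 1"
      by (simp add: r_def)
    then show ?thesis
      using norm_ge_zero[of m] unfolding power2_eq_1_iff by linarith
  qed
  also have "(\<forall>h\<in>defect_space. h = 0) \<longleftrightarrow> ?B"
  proof -
    have "Ft (adj (sub_space (orth_compl K)) H Ft h) = h \<longleftrightarrow> Q (defect_proj (lift h)) = 0" if "h \<in> range Q" for h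
      using fun_cong[OF defect_eq, of h] that by (auto simp: carr_H)
    then have "?B \<longleftrightarrow> (\<forall>h\<in>range Q. Q (defect_proj (lift h)) = 0)"
      by (simp add: carr_H)
    also have "\<dots> \<longleftrightarrow> (\<forall>h\<in>defect_space. h = 0)"
      using defect_space_fixed Q_defect_proj_in_space by (metis (no_types, lifting) defect_space_def mem_Collect_eq)
    finally show ?thesis by blast
  qed
  finally show ?thesis .
qed

end

section \<open>The norm-constrained interpolation problem\<close>

lemma adj_vec_op: "adj whole whole (vec_op x) y = cinner y (x::'a::complex_inner)"
proof -
  have "vec_op x \<in> bops whole whole"
    by (rule bops_wholeI[of _ "norm x"])
      (simp_all add: vec_op_def scaleC_add_left scaleC_complex_def scaleC_scaleC norm_scaleC)
  from cinner_adj[OF this, of 1 y] have "cinner x y = cnj (adj whole whole (vec_op x) y)"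
    by (simp add: vec_op_def scaleC_one cinner_complex_def)
  then show ?thesis
    by (metis cinner_commute complex_cnj_cnj)
qed

theorem theorem5p7:
  fixes A :: "'h::chilbert_space \<Rightarrow> 'x::chilbert_space"
    and T2 :: "'k::chilbert_space \<Rightarrow> 'h"
    and x :: 'x
    and F :: "'x \<Rightarrow> 'h"
    and S :: "'x \<Rightarrow> 'x"
    and HT :: "'h ipspace"
    and M :: "'x ipspace"
  assumes "separable (UNIV :: 'x set)" "separable (UNIV :: 'h set)" "separable (UNIV :: 'k set)"
    and "A \<in> bops whole whole"
    and "contraction whole whole T2"
    and "HT = dBR T2"
    and "F = (\<lambda>y. adj whole whole A y - T2 (adj whole whole T2 (adj whole whole A y)))"
    and "loewner_ge whole (adj whole HT F \<circ> F) (vec_op x \<circ> adj whole whole (vec_op x))"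
    and "S = op_sqrt whole (adj whole HT F \<circ> F)"
    and "M = sub_space (orth_compl (hker F))"
  shows "(\<exists>!xt. xt \<in> carr M \<and> x = S xt) \<and>
    (\<exists>!Ft. Ft \<in> bops M HT \<and> (\<forall>y. F y = Ft (S y))) \<and>
    (\<forall>xt Ft N.
       xt \<in> carr M \<and> x = S xt \<and>
       Ft \<in> bops M HT \<and> (\<forall>y. F y = Ft (S y)) \<and>
       N = hclosure HT (op_sqrt HT (\<lambda>h\<in>carr HT. h - Ft (adj M HT Ft h)) ` carr HT) \<longrightarrow>
         isometry M HT Ft \<and>
         {g \<in> carr HT. A g = x \<and> hnorm HT g \<le> 1}
           = {Ft xt + h | h. h \<in> N \<and> hnorm HT h \<le> sqrt (1 - (norm xt)\<^sup>2)} \<and>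
         ((\<exists>!g. g \<in> carr HT \<and> A g = x \<and> hnorm HT g \<le> 1)
           \<longleftrightarrow> norm xt = 1 \<or> (\<forall>h\<in>carr HT. Ft (adj M HT Ft h) = h)) \<and>
         (\<forall>g h. h \<in> N \<and> hnorm HT h \<le> sqrt (1 - (norm xt)\<^sup>2) \<and> g = Ft xt + h \<longrightarrow>
           (hnorm HT g)\<^sup>2 = (hnorm HT (Ft xt))\<^sup>2 + (hnorm HT h)\<^sup>2 \<and>
           (hnorm HT (Ft xt))\<^sup>2 + (hnorm HT h)\<^sup>2 = (norm xt)\<^sup>2 + (hnorm HT h)\<^sup>2))"
proof -
  note A = assms(4)
  define Q where "Q = defect_sqrt T2"
  obtain lift where or: "operator_range Q HT lift"
    and QQ: "\<And>y. Q (Q y) = y - T2 (adj whole whole T2 y)"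
    using dBR_operator_range[OF assms(5)] by (metis assms(6) Q_def)
  interpret operator_range Q HT lift
    by (rule or)
  define W where "W y = Q (adj whole whole A y)" for y
  have W: "W \<in> bops whole whole"
    using bops_comp[OF Qb bops_adj[OF A]] by (simp add: W_def[abs_def])
  have F: "F y = Q (W y)" for y
    by (simp add: assms(7) W_def QQ)
  have W_adj: "cinner (W y) l = cinner y (A (Q l))" for y l
    using cinner_adj[OF A, of "Q l" y] by (metis W_def Q_sym cinner_commute)
  then have adj_W: "adj whole whole W l = A (Q l)" for l
    by (rule cinner_ext[OF trans[OF cinner_adj[OF W, symmetric]]])
  have W_orth: "W y \<in> orth_compl (hker Q)" for y
    using psd_range_orth_ker[OF Q] by (auto simp: W_def)
  (* <F y, h> = <W y, lift h> = <y, A Q (lift h)> = <y, A h>. *)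
  have adj_F: "adj whole HT F h = A h" if h: "h \<in> range Q" for h
  proof (rule adj_eqI)
    show "ip HT (F y) h = ip whole y (A h)" for y
      using h W_adj[of y "lift h"] by (simp add: F ip_H lift_Q_cancel W_orth Q_lift)
    show "z' = A h" if "\<forall>y\<in>carr whole. ip whole y z' = ip whole y (A h)" for z'
      by (rule cinner_ext) (use that in simp)
  qed (use h in \<open>simp_all add: carr_H\<close>)
  have FF: "adj whole HT F \<circ> F = (\<lambda>y. A (Q (W y)))"
    by (simp add: fun_eq_iff F adj_F)
  have psd_FF: "psd whole (\<lambda>y. A (Q (W y)))"
  proof (rule psd_wholeI)
    show "(\<lambda>y. A (Q (W y))) \<in> bops whole whole"
      by (rule bops_comp[OF A bops_comp[OF Qb W]])
    show "cinner (A (Q (W y))) z = cinner y (A (Q (W z)))" for y z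
      by (metis W_adj cinner_commute)
    show "0 \<le> Re (cinner (A (Q (W y))) y)" for y
      using W_adj[of y "W y", symmetric] cinner_commute[of "A (Q (W y))" y] by (simp add: cinner_self)
  qed
  have S: "psd whole S" and SS: "S (S y) = A (Q (W y))" for y
    using op_sqrt_whole(1,2)[OF psd_FF] by (simp_all only: assms(9) FF)
  have "complex_of_real ((norm (W y))\<^sup>2) = complex_of_real ((norm (S y))\<^sup>2)" for y
    by (simp only: cinner_self[symmetric] W_adj psd_sym[OF S] SS)
  then have norm_WS: "norm (W y) = norm (S y)" for y
    by (simp only: of_real_eq_iff) (simp add: power2_eq_iff_nonneg)
  (* Q is injective on (Ker Q)^perp, which contains W y. *)
  have "F y = 0 \<longleftrightarrow> W y = 0" for y
    using lift_Q_cancel[OF W_orth[of y]] lift_Q_cancel[OF orth_compl_zero]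
    by (metis F bops_zero[OF Qb])
  then have "F y = 0 \<longleftrightarrow> S y = 0" for y
    using norm_WS[of y] by (metis norm_eq_zero)
  then have M: "M = sub_space (orth_compl (hker S))"
    by (simp add: assms(10) hker_def)
  (* The hypothesis F^[*] F >= x x^* at y reads |<y, x>|^2 <= |S y|^2. *)
  have x_bound: "cmod (cinner y x) \<le> 1 * norm (S y)" for y
  proof -
    have "0 \<le> Re (cinner (A (Q (W y)) - cinner y x *\<^sub>C x) y)"
      using psd_ge[OF assms(8)[unfolded loewner_ge_def FF], of y]
      by (simp add: adj_vec_op) (simp add: vec_op_def)
    also have "cinner (A (Q (W y)) - cinner y x *\<^sub>C x) y
        = complex_of_real ((norm (S y))\<^sup>2) - complex_of_real ((cmod (cinner y x))\<^sup>2)"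
    proof -
      have "cinner (A (Q (W y))) y = complex_of_real ((norm (S y))\<^sup>2)"
        by (simp only: SS[symmetric] psd_sym[OF S, of "S y"] cinner_self)
      moreover have "cinner y x * cinner x y = complex_of_real ((cmod (cinner y x))\<^sup>2)"
        by (metis complex_norm_square cinner_commute)
      ultimately show ?thesis
        by (simp only: cinner_diff_left cinner_scaleC_left)
    qed
    finally have "(cmod (cinner y x))\<^sup>2 \<le> (norm (S y))\<^sup>2"
      by simp
    from power2_le_imp_le[OF this norm_ge_zero] show ?thesis
      by simp
  qed
  obtain x0 where x0: "x0 \<in> orth_compl (hker S)" "norm x0 \<le> 1" "S x0 = x"
    using Douglas_vector[OF S zero_le_one x_bound] unfolding orth_ker_eq_closure_range[OF S] by blast
  have xt_eq: "xt = x0" if "xt \<in> carr M" "x = S xt" for xt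
    by (rule psd_inj_on[OF S]) (use that x0 M in simp_all)
  obtain V V' where V: "V \<in> bops whole whole" and V': "V' \<in> bops whole whole"
    and VV': "\<And>m l. cinner (V m) l = cinner m (V' l)" and VS: "\<And>y. V (S y) = W y"
    and SV': "\<And>l. S (V' l) = A (Q l)" and V'_in: "\<And>l. V' l \<in> orth_compl (hker S)"
    and V'V: "\<And>m. m \<in> orth_compl (hker S) \<Longrightarrow> V' (V m) = m"
    using polar_decomposition[OF S W norm_WS] unfolding adj_W by blast
  (* S V' k = A Q k = 0 for k in Ker Q, so V' vanishes there and V maps into its complement. *)
  have V_orth: "V m \<in> orth_compl (hker Q)" for m
  proof -
    have "V' k = 0" if "k \<in> hker Q" for k
      by (rule psd_inj_on[OF S V'_in orth_compl_zero])
        (use that in \<open>simp add: SV' hker_def bops_zero[OF A] bops_zero[OF psd_bops[OF S]]\<close>)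
    then show ?thesis
      by (simp add: orth_compl_def VV')
  qed
  have Ft_eq: "Ft m = Q (V m)" if "Ft \<in> bops M HT" "\<forall>y. F y = Ft (S y)" "m \<in> orth_compl (hker S)" for Ft m
    by (rule bops_eq_of_eq_on_range[OF S V V_orth]) (use that in \<open>simp_all add: M VS F[symmetric]\<close>)
  have fact: "isometric_factor Q HT lift (hker S) V V' Ft"
    if "Ft \<in> bops M HT" "\<forall>y. F y = Ft (S y)" for Ft
    by unfold_locales (use V V' VV' V'_in V'V V_orth Ft_eq[OF that] that M in auto)
  have ex_xt: "\<exists>!xt. xt \<in> carr M \<and> x = S xt"
  proof (rule ex1I)
    show "x0 \<in> carr M \<and> x = S x0"
      by (simp add: M x0)
  qed (use xt_eq in blast)
  have ex_Ft: "\<exists>!Ft. Ft \<in> bops M HT \<and> (\<forall>y. F y = Ft (S y))"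
  proof (rule ex1I)
    define F0 where "F0 = (\<lambda>m\<in>carr M. Q (V m))"
    obtain b where b: "\<And>m. norm (V m) \<le> b * norm m"
      using bops_pos_bound[OF V] by blast
    have "F0 \<in> bops M HT"
      unfolding bops_def
    proof (intro CollectI conjI ballI allI exI[of _ b])
      show "F0 \<in> carr M \<rightarrow>\<^sub>E carr HT"
        by (auto simp: F0_def carr_H)
      fix m n c assume m: "m \<in> carr M"
      show "F0 (c *\<^sub>C m) = c *\<^sub>C F0 m"
        using m by (simp add: F0_def M orth_compl_scaleC bops_scaleC[OF V] bops_scaleC[OF Qb])
      show "hnorm HT (F0 m) \<le> b * hnorm M m"
        using m b by (simp add: F0_def M hnorm_H lift_Q_cancel V_orth)
      assume n: "n \<in> carr M"
      show "F0 (m + n) = F0 m + F0 n"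
        using m n by (simp add: F0_def M orth_compl_add bops_add[OF V] bops_add[OF Qb])
    qed
    moreover have "F y = F0 (S y)" for y
      using psd_range_orth_ker[OF S] by (auto simp: F0_def M F VS)
    ultimately show "F0 \<in> bops M HT \<and> (\<forall>y. F y = F0 (S y))"
      by blast
    fix Ft assume Ft: "Ft \<in> bops M HT \<and> (\<forall>y. F y = Ft (S y))"
    show "Ft = F0"
    proof
      fix m
      show "Ft m = F0 m"
      proof (cases "m \<in> carr M")
        case True
        then show ?thesis
          using Ft Ft_eq[of Ft m] by (simp add: F0_def M)
      next
        case False
        then show ?thesis
          using Ft by (auto simp: F0_def bops_def PiE_def extensional_def)
      qed
    qed
  qed
  (* A g = W* lift g = S V* lift g, and S is injective on (Ker S)^perp. *)
  have A_iff: "A g = x \<longleftrightarrow> V' (lift g) = x0" if g: "g \<in> range Q" for g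
  proof -
    have "A g = S (V' (lift g))"
      using g by (simp add: SV' Q_lift)
    then show ?thesis
      using psd_inj_on[OF S V'_in x0(1)] x0(3) by metis
  qed
  show ?thesis
  proof (intro conjI ex_xt ex_Ft allI impI; (elim conjE)?)
    fix xt Ft N
    assume xt: "xt \<in> carr M" "x = S xt" and Ft: "Ft \<in> bops M HT" "\<forall>y. F y = Ft (S y)"
      and N: "N = hclosure HT (op_sqrt HT (\<lambda>h\<in>carr HT. h - Ft (adj M HT Ft h)) ` carr HT)"
    interpret I: isometric_factor Q HT lift "hker S" V V' Ft
      by (rule fact[OF Ft])
    have xt0: "xt = x0"
      by (rule xt_eq[OF xt])
    have N: "N = I.defect_space"
      using N I.closure_range_defect by (simp add: M)
    show "isometry M HT Ft"
      using I.isometry_Ft by (simp add: M)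
    have "{g \<in> carr HT. A g = x \<and> hnorm HT g \<le> 1} = {g \<in> range Q. V' (lift g) = xt \<and> hnorm HT g \<le> 1}"
      using A_iff by (auto simp: carr_H xt0)
    then show sol: "{g \<in> carr HT. A g = x \<and> hnorm HT g \<le> 1}
        = {Ft xt + h | h. h \<in> N \<and> hnorm HT h \<le> sqrt (1 - (norm xt)\<^sup>2)}"
      using I.solution_set[OF x0(1)] by (simp add: N xt0)
    have "(\<exists>!g. g \<in> carr HT \<and> A g = x \<and> hnorm HT g \<le> 1)
        \<longleftrightarrow> (\<exists>!g. g \<in> {g \<in> carr HT. A g = x \<and> hnorm HT g \<le> 1})"
      by simp
    also have "\<dots> \<longleftrightarrow> norm xt = 1 \<or> (\<forall>h\<in>carr HT. Ft (adj M HT Ft h) = h)"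
      unfolding sol using I.unique_solution_iff[OF x0(1,2)] by (simp only: N xt0 M)
    finally show "(\<exists>!g. g \<in> carr HT \<and> A g = x \<and> hnorm HT g \<le> 1)
        \<longleftrightarrow> norm xt = 1 \<or> (\<forall>h\<in>carr HT. Ft (adj M HT Ft h) = h)" .
    fix g h assume h: "h \<in> N" and g: "g = Ft xt + h"
    show "(hnorm HT g)\<^sup>2 = (hnorm HT (Ft xt))\<^sup>2 + (hnorm HT h)\<^sup>2"
      "(hnorm HT (Ft xt))\<^sup>2 + (hnorm HT h)\<^sup>2 = (norm xt)\<^sup>2 + (hnorm HT h)\<^sup>2"
      using I.norm_Pythagoras[OF x0(1)] I.hnorm_Ft[OF x0(1)] h by (simp_all add: g N xt0)
  qed
qed

end
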